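(* Let $\kappa$ be an uncountable regular cardinal with $\kappa^{<\kappa}=\kappa$. Suppose $\mathbb{P}$ is a ${<}\kappa$-distributive tree forcing, $h:\kappa^{<\kappa}\to\kappa^{<\kappa}$ is a pre-continuous function in the ground model with $f=\lim(h)$, and $T\in\mathbb{P}$ is such that $T\Vdash$ "$f(\dot x_{gen})$ is a dominating $\kappa$-real" (over the ground model). Then $T\Vdash$ "there is a Cohen $\kappa$-real".
   Context: A tree $T\subseteq\kappa^{<\kappa}$ (closed under initial segments) is limit-closed if the union of any $\subseteq$-increasing sequence from $T$ of limit length $<\kappa$ lies in $T$. A tree forcing is a forcing whose conditions are limit-closed trees $T\subseteq\kappa^{<\kappa}$ ordered by inclusion, such that for every $T\in\mathbb{P}$ and $\sigma\in T$, $T\uparrow\sigma=\{\tau\in T:\sigma\subseteq\tau\lor\tau\subseteq\sigma\}\in\mathbb{P}$. ${<}\kappa$-distributive: the intersection of fewer than $\kappa$ open dense sets is open dense. $\dot x_{gen}$ is the canonical name for the generic $\kappa$-real (the element of $\kappa^\kappa$ whose initial segments are the $\sigma$ lying in every condition of the generic filter). $h$ is pre-continuous if $\sigma\subseteq\tau$ implies $h(\sigma)\subseteq h(\tau)$, and for every $x\in\kappa^\kappa$ the set $\{\mathrm{len}(h(\sigma)):\sigma\subseteq x\}$ is cofinal in $\kappa$; $\lim(h)(x)=\bigcup\{h(\sigma):\sigma\subseteq x\}$ (the hypothesis includes that $f(\dot x_{gen})$ is forced to be an element of $\kappa^\kappa$). $d\in\kappa^\kappa$ is dominating over the ground model $V$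 if for every $g\in\kappa^\kappa\cap V$ there is $\alpha_0$ with $g(\alpha)\le d(\alpha)$ for all $\alpha>\alpha_0$. A Cohen $\kappa$-real is an element of $2^\kappa$ generic over $V$ for $\kappa$-Cohen forcing ($2^{<\kappa}$ ordered by end-extension). *)

theory Defs
  imports Main
begin

unbundle cardinal_syntax

section \<open>The cardinal \<open>\<kappa>\<close> and sequences of length less than \<open>\<kappa>\<close>\<close>

text \<open>
  The cardinal \<open>\<kappa>\<close> is given by a well-ordered type \<open>'k\<close> whose order is an initial ordinal; the
  elements of \<open>'k\<close> are the ordinals below \<open>\<kappa>\<close>.  Sequences are identified with their graphs, so that
  inclusion is the initial segment relation and unions of chains are plain unions of sets.
  Ground model elements of \<open>\<kappa>\<^sup>\<kappa>\<close> are the functions \<open>'k \<Rightarrow> 'k\<close>, and \<open>2\<close> is the type \<open>bool\<close>.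
\<close>

definition ord_le :: "'k::wellorder rel" where
  "ord_le = {(\<alpha>, \<beta>). \<alpha> \<le> \<beta>}"

definition seqs :: "('k::wellorder \<times> 'a) set set" where
  "seqs = {\<sigma>. single_valued \<sigma> \<and> (\<exists>\<alpha>. Domain \<sigma> = {..<\<alpha>})}"

definition len :: "('k::wellorder \<times> 'a) set \<Rightarrow> 'k" where
  "len \<sigma> = (THE \<alpha>. Domain \<sigma> = {..<\<alpha>})"

definition graph_of :: "('k \<Rightarrow> 'a) \<Rightarrow> ('k \<times> 'a) set" where
  "graph_of x = {(\<alpha>, x \<alpha>) | \<alpha>. True}"

definition limit_length :: "'k::wellorder \<Rightarrow> bool" where
  "limit_length \<mu> \<longleftrightarrow> (\<exists>\<beta>. \<beta> < \<mu>) \<and> (\<forall>\<beta><\<mu>. \<exists>\<gamma><\<mu>. \<beta> < \<gamma>)"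

text \<open>Whether \<open>h\<close> is a ground model function is not an issue: all objects of the logic are.\<close>

definition pre_continuous ::
    "(('k::wellorder \<times> 'k) set \<Rightarrow> ('k \<times> 'k) set) \<Rightarrow> bool" where
  "pre_continuous h \<longleftrightarrow>
     (\<forall>\<sigma>\<in>seqs. h \<sigma> \<in> seqs) \<and>
     (\<forall>\<sigma>\<in>seqs. \<forall>\<tau>\<in>seqs. \<sigma> \<subseteq> \<tau> \<longrightarrow> h \<sigma> \<subseteq> h \<tau>) \<and>
     (\<forall>x :: 'k \<Rightarrow> 'k. \<forall>\<alpha>. \<exists>\<sigma>\<in>seqs. \<sigma> \<subseteq> graph_of x \<and> \<alpha> \<le> len (h \<sigma>))"

section \<open>Tree forcings\<close>

definition is_tree :: "('k::wellorder \<times> 'k) set set \<Rightarrow> bool" where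
  "is_tree T \<longleftrightarrow> T \<subseteq> seqs \<and> (\<forall>\<tau>\<in>T. \<forall>\<sigma>\<in>seqs. \<sigma> \<subseteq> \<tau> \<longrightarrow> \<sigma> \<in> T)"

definition limit_closed :: "('k::wellorder \<times> 'k) set set \<Rightarrow> bool" where
  "limit_closed T \<longleftrightarrow>
     (\<forall>(\<mu> :: 'k) s. limit_length \<mu> \<and> (\<forall>\<iota><\<mu>. s \<iota> \<in> T) \<and> (\<forall>\<iota> \<iota>'. \<iota> \<le> \<iota>' \<and> \<iota>' < \<mu> \<longrightarrow> s \<iota> \<subseteq> s \<iota>')
        \<longrightarrow> (\<Union>\<iota>\<in>{..<\<mu>}. s \<iota>) \<in> T)"

definition tree_restrict ::
    "('k::wellorder \<times> 'k) set set \<Rightarrow> ('k \<times> 'k) set \<Rightarrow> ('k \<times> 'k) set set" where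
  "tree_restrict T \<sigma> = {\<tau> \<in> T. \<sigma> \<subseteq> \<tau> \<or> \<tau> \<subseteq> \<sigma>}"

definition tree_forcing :: "('k::wellorder \<times> 'k) set set set \<Rightarrow> bool" where
  "tree_forcing P \<longleftrightarrow>
     (\<forall>T\<in>P. is_tree T \<and> limit_closed T \<and> (\<forall>\<sigma>\<in>T. tree_restrict T \<sigma> \<in> P))"

section \<open>Posets\<close>

text \<open>In \<open>le p q\<close> the condition \<open>p\<close> is the stronger one.\<close>

definition dense_in :: "('p \<Rightarrow> 'p \<Rightarrow> bool) \<Rightarrow> 'p set \<Rightarrow> 'p set \<Rightarrow> bool" where
  "dense_in le P D \<longleftrightarrow> D \<subseteq> P \<and> (\<forall>p\<in>P. \<exists>q\<in>D. le q p)"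

definition open_dense_in :: "('p \<Rightarrow> 'p \<Rightarrow> bool) \<Rightarrow> 'p set \<Rightarrow> 'p set \<Rightarrow> bool" where
  "open_dense_in le P D \<longleftrightarrow> dense_in le P D \<and> (\<forall>p\<in>D. \<forall>q\<in>P. le q p \<longrightarrow> q \<in> D)"

definition lt_distributive :: "'k rel \<Rightarrow> ('p \<Rightarrow> 'p \<Rightarrow> bool) \<Rightarrow> 'p set \<Rightarrow> bool" where
  "lt_distributive \<kappa> le P \<longleftrightarrow>
     (\<forall>\<D>. |\<D>| <o \<kappa> \<and> (\<forall>D\<in>\<D>. open_dense_in le P D) \<longrightarrow> open_dense_in le P (P \<inter> \<Inter>\<D>))"

section \<open>The forcing relation\<close>

text \<open>
  The ground model \<open>V\<close> is the universe of the logic.  A formula of the forcing language over a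
  forcing \<open>P\<close> (a set of conditions, ordered by the order of the type) is interpreted by the set of
  conditions forcing it, with the usual recursive clauses for negation, conjunction and universal
  quantification; the other connectives are the classical abbreviations.

  Every subset, in the generic extension, of a ground model set \<open>A\<close> has a nice name, that is, a name
  of the form \<open>{(a, p), \<dots>}\<close> with \<open>a \<in> A\<close> (standing for its
  canonical name) and \<open>p \<in> P\<close>.  As all objects spoken about below
  are subsets of ground model sets, names are taken to be nice; pairs whose second component is
  not a condition are ignored.  Quantifying over a type of ground model objects expresses
  quantification over elements of \<open>V\<close>, quantifying over a type of names expresses quantification
  over subsets of a ground model set in the extension.
\<close>

type_synonym 'p fml = "'p set \<Rightarrow> 'p \<Rightarrow> bool"
type_synonym ('a, 'p) name = "('a \<times> 'p) set"

definition forces :: "'p set \<Rightarrow> 'p \<Rightarrow> 'p fml \<Rightarrow> bool" where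
  "forces P p \<phi> \<longleftrightarrow> \<phi> P p"

text \<open>\<open>fGround b\<close> is an assertion \<open>b\<close> about ground model objects, absolute for the extension.\<close>

definition fGround :: "bool \<Rightarrow> 'p fml" where
  "fGround b = (\<lambda>P p. b)"

text \<open>\<open>a \<in> \<tau>\<close>: the conditions below some \<open>s\<close> with \<open>(a, s) \<in> \<tau>\<close> are dense below \<open>p\<close>.\<close>

definition fMem :: "'a \<Rightarrow> ('a, 'p::order) name \<Rightarrow> 'p fml" where
  "fMem a \<tau> = (\<lambda>P p. \<forall>q\<in>P. q \<le> p \<longrightarrow> (\<exists>r\<in>P. r \<le> q \<and> (\<exists>s\<in>P. (a, s) \<in> \<tau> \<and> r \<le> s)))"

definition fNot :: "('p::order) fml \<Rightarrow> 'p fml" where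
  "fNot \<phi> = (\<lambda>P p. \<forall>q\<in>P. q \<le> p \<longrightarrow> \<not> forces P q \<phi>)"

definition fAnd :: "'p fml \<Rightarrow> 'p fml \<Rightarrow> 'p fml" where
  "fAnd \<phi> \<psi> = (\<lambda>P p. forces P p \<phi> \<and> forces P p \<psi>)"

definition fBall :: "'x set \<Rightarrow> ('x \<Rightarrow> 'p fml) \<Rightarrow> 'p fml" where
  "fBall A \<phi> = (\<lambda>P p. \<forall>x\<in>A. forces P p (\<phi> x))"

definition fImp :: "('p::order) fml \<Rightarrow> 'p fml \<Rightarrow> 'p fml" where
  "fImp \<phi> \<psi> = fNot (fAnd \<phi> (fNot \<psi>))"

definition fBex :: "'x set \<Rightarrow> ('x \<Rightarrow> ('p::order) fml) \<Rightarrow> 'p fml" where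
  "fBex A \<phi> = fNot (fBall A (\<lambda>x. fNot (\<phi> x)))"

text \<open>A name for \<open>{a. \<phi> a}\<close>:\<close>

definition name_Collect :: "'p set \<Rightarrow> ('a \<Rightarrow> 'p fml) \<Rightarrow> ('a, 'p) name" where
  "name_Collect P \<phi> = {(a, p). p \<in> P \<and> forces P p (\<phi> a)}"

definition fSubset :: "'a set \<Rightarrow> ('a, 'p::order) name \<Rightarrow> 'p fml" where
  "fSubset A \<tau> = fBall A (\<lambda>a. fMem a \<tau>)"

text \<open>\<open>\<tau>\<close> is (the graph of) a total function on \<open>\<kappa>\<close>:\<close>

definition fFunction :: "('k \<times> 'a, 'p::order) name \<Rightarrow> 'p fml" where
  "fFunction \<tau> =
     fAnd (fBall UNIV (\<lambda>\<alpha>. fBex UNIV (\<lambda>\<beta>. fMem (\<alpha>, \<beta>) \<tau>)))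
          (fBall UNIV (\<lambda>\<alpha>. fBall UNIV (\<lambda>\<beta>. fBall UNIV (\<lambda>\<beta>'.
             fImp (fAnd (fMem (\<alpha>, \<beta>) \<tau>) (fMem (\<alpha>, \<beta>') \<tau>)) (fGround (\<beta> = \<beta>'))))))"

section \<open>The generic \<open>\<kappa>\<close>-real and its image\<close>

definition filter_name :: "'p set \<Rightarrow> ('p, 'p) name" where
  "filter_name P = {(p, p) | p. p \<in> P}"

text \<open>The union of all \<open>\<sigma>\<close> lying in every condition of the generic filter:\<close>

definition x_gen ::
    "('k::wellorder \<times> 'k) set set set \<Rightarrow> ('k \<times> 'k, ('k \<times> 'k) set set) name" where
  "x_gen P = name_Collect P (\<lambda>z.
     fBex seqs (\<lambda>\<sigma>. fAnd (fGround (z \<in> \<sigma>))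
       (fBall P (\<lambda>S. fImp (fMem S (filter_name P)) (fGround (\<sigma> \<in> S))))))"

text \<open>
  The name for \<open>lim(h)(\<tau>) = \<Union>{h(\<sigma>). \<sigma> \<subseteq> \<tau>}\<close>.  That this is a total function has to be forced
  separately.
\<close>

definition lim_name ::
    "'p::order set \<Rightarrow> (('k::wellorder \<times> 'k) set \<Rightarrow> ('k \<times> 'k) set) \<Rightarrow>
     ('k \<times> 'k, 'p) name \<Rightarrow> ('k \<times> 'k, 'p) name" where
  "lim_name P h \<tau> = name_Collect P (\<lambda>z.
     fBex seqs (\<lambda>\<sigma>. fAnd (fSubset \<sigma> \<tau>) (fGround (z \<in> h \<sigma>))))"

section \<open>Dominating and Cohen reals\<close>

text \<open>The ground model function \<open>g\<close> satisfies \<open>g(\<alpha>) \<le> d(\<alpha>)\<close> for all large \<open>\<alpha>\<close>.\<close>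

definition fDominating :: "('k::wellorder \<times> 'k, 'p::order) name \<Rightarrow> 'p fml" where
  "fDominating d = fAnd (fFunction d)
     (fBall UNIV (\<lambda>g :: 'k \<Rightarrow> 'k. fBex UNIV (\<lambda>\<alpha>\<^sub>0. fBall {\<alpha>\<^sub>0<..} (\<lambda>\<alpha>.
        fBex {g \<alpha>..} (\<lambda>\<beta>. fMem (\<alpha>, \<beta>) d)))))"

text \<open>\<open>\<Gamma>\<close> is a \<open>V\<close>-generic filter on the ground model poset \<open>(Q, le)\<close>.\<close>

definition fGenericFilter ::
    "('q \<Rightarrow> 'q \<Rightarrow> bool) \<Rightarrow> 'q set \<Rightarrow> ('q \<Rightarrow> ('p::order) fml) \<Rightarrow> 'p fml" where
  "fGenericFilter le Q \<Gamma> =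
     fAnd (fBall Q (\<lambda>\<sigma>. fBall {\<tau> \<in> Q. le \<sigma> \<tau>} (\<lambda>\<tau>. fImp (\<Gamma> \<sigma>) (\<Gamma> \<tau>))))
    (fAnd (fBall Q (\<lambda>\<sigma>. fBall Q (\<lambda>\<tau>.
             fImp (fAnd (\<Gamma> \<sigma>) (\<Gamma> \<tau>)) (fBex {\<rho> \<in> Q. le \<rho> \<sigma> \<and> le \<rho> \<tau>} \<Gamma>))))
          (fBall {D. dense_in le Q D} (\<lambda>D. fBex D \<Gamma>)))"

text \<open>
  \<open>c \<in> 2\<^sup>\<kappa>\<close> and the initial segments of \<open>c\<close> form a \<open>V\<close>-generic filter on \<open>2\<^sup><\<^sup>\<kappa>\<close>, ordered by
  end-extension.
\<close>

definition fCohen :: "('k::wellorder \<times> bool, 'p::order) name \<Rightarrow> 'p fml" where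
  "fCohen c = fAnd (fFunction c) (fGenericFilter (\<supseteq>) seqs (\<lambda>\<sigma>. fSubset \<sigma> c))"

end

theory Submission
  imports Defs
begin

text \<open>
  Let \<open>d = f(x)\<close> be the dominating real and fix an injection \<open>code\<close> of \<open>\<kappa>\<^sup><\<^sup>\<kappa>\<close> into \<open>\<kappa>\<close>.  For every
  \<open>\<phi>\<close> in the ground model, \<open>d(code(x|\<gamma>)) > \<phi>(x|\<gamma>)\<close> for all large \<open>\<gamma>\<close>.  Hence below every
  condition \<open>R\<close> there is a node from which \<open>R\<close> is Laver-like for \<open>\<omega>\<close> steps: otherwise the open game
  in which one player names bounds and the other extends the node so that \<open>d(code(\<sigma>))\<close> exceeds
  them is won by the first player at every node, while a dominating \<open>d\<close> beats the supremum of
  the strategies.  The suprema of the values of \<open>d\<close> along such plays of length \<open>\<omega>\<close>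
  meet every stationary set of ordinals of cofinality \<open>\<omega>\<close>.  So partition these ordinals into
  \<open>\<kappa>\<close> stationary sets, indexed by \<open>2\<^sup><\<^sup>\<kappa>\<close>, cut \<open>x\<close> into blocks of \<open>\<omega>\<close> steps, and let each block
  name the element of \<open>2\<^sup><\<^sup>\<kappa>\<close> to which the part of the Cohen real built so far is extended.  A
  single block can then bring it into a given dense set, so that no further limit of blocks has
  to be controlled inside a condition.
\<close>

section \<open>Sequences\<close>

lemma seqs_Domain: "\<sigma> \<in> seqs \<Longrightarrow> Domain \<sigma> = {..<len \<sigma>}"
proof -
  assume "\<sigma> \<in> seqs"
  then obtain \<alpha> where \<alpha>: "Domain \<sigma> = {..<\<alpha>}" unfolding seqs_def by auto
  then have "len \<sigma> = \<alpha>" unfolding len_def by (auto simp: lessThan_eq_iff)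
  with \<alpha> show ?thesis by simp
qed

lemma seqs_Domain_iff: "\<sigma> \<in> seqs \<Longrightarrow> \<alpha> \<in> Domain \<sigma> \<longleftrightarrow> \<alpha> < len \<sigma>"
  by (simp add: seqs_Domain)

lemma seqs_single_valued: "\<sigma> \<in> seqs \<Longrightarrow> single_valued \<sigma>"
  by (simp add: seqs_def)

lemma seqs_down: "\<sigma> \<in> seqs \<Longrightarrow> \<beta> \<in> Domain \<sigma> \<Longrightarrow> \<alpha> \<le> \<beta> \<Longrightarrow> \<alpha> \<in> Domain \<sigma>"
  by (auto simp: seqs_Domain_iff)

lemma seqs_empty [simp]: "{} \<in> (seqs :: ('k::wellorder \<times> 'a) set set)"
proof -
  have "Domain {} = {..<(LEAST \<alpha>::'k. True)}"
    using not_less_Least by blast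
  then show ?thesis unfolding seqs_def by (auto simp: single_valued_def)
qed

lemma seqs_subset_len: "\<sigma> \<in> seqs \<Longrightarrow> \<tau> \<in> seqs \<Longrightarrow> \<sigma> \<subseteq> \<tau> \<Longrightarrow> len \<sigma> \<le> len \<tau>"
  by (metis Domain_mono lessThan_subset_iff seqs_Domain)

lemma single_valued_union_Domain_subset:
  assumes "single_valued (\<sigma> \<union> \<tau>)" "Domain \<sigma> \<subseteq> Domain \<tau>" shows "\<sigma> \<subseteq> \<tau>"
proof
  fix z assume "z \<in> \<sigma>"
  moreover obtain a b where "z = (a, b)" by fastforce
  moreover have "a \<in> Domain \<tau>" using calculation assms(2) by auto
  ultimately show "z \<in> \<tau>" using assms(1) unfolding single_valued_def by (metis Domain_iff UnCI)
qed

lemma seqs_comparable: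
  assumes "\<sigma> \<in> seqs" "\<tau> \<in> seqs" "single_valued (\<sigma> \<union> \<tau>)" shows "\<sigma> \<subseteq> \<tau> \<or> \<tau> \<subseteq> \<sigma>"
proof -
  have "Domain \<sigma> \<subseteq> Domain \<tau> \<or> Domain \<tau> \<subseteq> Domain \<sigma>"
    using assms(1,2) by (auto simp: seqs_Domain)
  then show ?thesis
    using single_valued_union_Domain_subset[of \<sigma> \<tau>] single_valued_union_Domain_subset[of \<tau> \<sigma>] assms(3)
    by (metis Un_commute)
qed

lemma seqs_below_comparable:
  assumes "\<sigma> \<in> seqs" "\<tau> \<in> seqs" "\<chi> \<in> seqs" "\<sigma> \<subseteq> \<chi>" "\<tau> \<subseteq> \<chi>" shows "\<sigma> \<subseteq> \<tau> \<or> \<tau> \<subseteq> \<sigma>"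
proof (rule seqs_comparable[OF assms(1,2)])
  show "single_valued (\<sigma> \<union> \<tau>)"
    by (rule single_valued_subset[OF _ seqs_single_valued[OF assms(3)]]) (use assms in auto)
qed

lemma seqs_subset_eq:
  assumes "\<sigma> \<in> seqs" "\<tau> \<in> seqs" "\<sigma> \<subseteq> \<tau>" "len \<tau> \<le> len \<sigma>" shows "\<sigma> = \<tau>"
proof
  show "\<tau> \<subseteq> \<sigma>"
  proof (rule single_valued_union_Domain_subset)
    show "single_valued (\<tau> \<union> \<sigma>)" using assms by (metis Un_absorb2 seqs_single_valued)
    show "Domain \<tau> \<subseteq> Domain \<sigma>" using assms by (auto simp: seqs_Domain)
  qed
qed (fact assms)

lemma seqs_psubset_len: "\<sigma> \<in> seqs \<Longrightarrow> \<tau> \<in> seqs \<Longrightarrow> \<sigma> \<subset> \<tau> \<Longrightarrow> len \<sigma> < len \<tau>"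
  by (metis leI psubsetE seqs_subset_eq subset_refl)

lemma wf_seqs_psubset: "wf {(\<rho>, \<sigma>). \<rho> \<in> seqs \<and> \<sigma> \<in> seqs \<and> \<rho> \<subset> \<sigma>}"
  by (rule wf_subset[OF wf_inv_image[OF wf, of len]])
    (use seqs_psubset_len in \<open>auto simp: inv_image_def\<close>)

text \<open>The least length attained by the initial segments of \<open>\<tau>\<close> with property
  \<open>Q\<close> provides the witness. Next nodes and milestones are found in this way.\<close>

lemma seqs_minimal:
  assumes "\<tau> \<in> seqs" "Q \<tau>"
  obtains \<rho> where "\<rho> \<in> seqs" "\<rho> \<subseteq> \<tau>" "Q \<rho>" "\<And>\<pi>. \<pi> \<in> seqs \<Longrightarrow> \<pi> \<subset> \<rho> \<Longrightarrow> \<not> Q \<pi>"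
proof -
  let ?L = "\<lambda>\<alpha>. \<exists>\<rho>\<in>seqs. \<rho> \<subseteq> \<tau> \<and> Q \<rho> \<and> len \<rho> = \<alpha>"
  have "?L (len \<tau>)" using assms by blast
  then have "?L (LEAST \<alpha>. ?L \<alpha>)" by (rule LeastI)
  then obtain \<rho> where \<rho>: "\<rho> \<in> seqs" "\<rho> \<subseteq> \<tau>" "Q \<rho>" "len \<rho> = (LEAST \<alpha>. ?L \<alpha>)" by blast
  show ?thesis
  proof (rule that[OF \<rho>(1-3)])
    fix \<pi> assume \<pi>: "\<pi> \<in> seqs" "\<pi> \<subset> \<rho>"
    then have "len \<pi> < (LEAST \<alpha>. ?L \<alpha>)" using seqs_psubset_len[OF \<pi>(1) \<rho>(1)] \<rho>(4) by simp
    then have "\<not> ?L (len \<pi>)" by (rule not_less_Least)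
    then show "\<not> Q \<pi>" using \<pi> \<rho>(2) by blast
  qed
qed

lemma seqs_restrict_less: "\<sigma> \<in> seqs \<Longrightarrow> {z \<in> \<sigma>. fst z < \<delta>} \<in> seqs"
proof -
  assume s: "\<sigma> \<in> seqs"
  have "Domain {z \<in> \<sigma>. fst z < \<delta>} = {..<min \<delta> (len \<sigma>)}"
    using seqs_Domain[OF s] by (auto simp: set_eq_iff Domain_iff)
  then show ?thesis using s unfolding seqs_def by (auto simp: single_valued_def)
qed

text \<open>The bound \<open>\<beta>\<close> keeps the union shorter than \<kappa>. Its length is
  the supremum \<open>\<gamma>\<close> of the lengths.\<close>

lemma seqs_Union:
  fixes X :: "('k::wellorder \<times> 'a) set set"
  assumes X: "X \<subseteq> seqs" "\<And>\<sigma> \<tau>. \<sigma> \<in> X \<Longrightarrow> \<tau> \<in> X \<Longrightarrow> \<sigma> \<subseteq> \<tau> \<or> \<tau> \<subseteq> \<sigma>"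
    and b: "\<And>\<sigma>. \<sigma> \<in> X \<Longrightarrow> len \<sigma> \<le> \<beta>"
  shows "\<Union>X \<in> seqs"
proof -
  have "single_valued (\<Union>X)"
    unfolding single_valued_def
  proof (intro allI impI)
    fix x y z assume "(x, y) \<in> \<Union>X" "(x, z) \<in> \<Union>X"
    then obtain \<sigma> \<tau> where "\<sigma> \<in> X" "\<tau> \<in> X" "(x, y) \<in> \<sigma>" "(x, z) \<in> \<tau>" by auto
    moreover from this X obtain \<chi> where "\<chi> \<in> X" "(x, y) \<in> \<chi>" "(x, z) \<in> \<chi>" by blast
    ultimately show "y = z" using X(1) seqs_single_valued unfolding single_valued_def by blast
  qed
  moreover
  define \<gamma> where "\<gamma> = (LEAST \<gamma>. \<forall>\<sigma>\<in>X. len \<sigma> \<le> \<gamma>)"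
  have \<gamma>: "\<forall>\<sigma>\<in>X. len \<sigma> \<le> \<gamma>" unfolding \<gamma>_def by (rule LeastI[of _ \<beta>]) (use b in auto)
  have "Domain (\<Union>X) = {..<\<gamma>}"
  proof (intro set_eqI iffI)
    fix \<alpha> assume "\<alpha> \<in> Domain (\<Union>X)"
    then obtain \<sigma> where "\<sigma> \<in> X" "\<alpha> \<in> Domain \<sigma>" by auto
    then have "\<alpha> < len \<sigma>" using X(1) by (metis seqs_Domain_iff subsetD)
    also have "\<dots> \<le> \<gamma>" using \<gamma> \<open>\<sigma> \<in> X\<close> by auto
    finally show "\<alpha> \<in> {..<\<gamma>}" by simp
  next
    fix \<alpha> assume "\<alpha> \<in> {..<\<gamma>}"
    then have "\<not> (\<forall>\<sigma>\<in>X. len \<sigma> \<le> \<alpha>)" unfolding \<gamma>_def using not_less_Least by blast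
    then obtain \<sigma> where s: "\<sigma> \<in> X" "\<alpha> < len \<sigma>" by (auto simp: not_le)
    then have "\<alpha> \<in> Domain \<sigma>" using X(1) by (auto simp: seqs_Domain_iff)
    with s show "\<alpha> \<in> Domain (\<Union>X)" by blast
  qed
  ultimately show ?thesis unfolding seqs_def by blast
qed

text \<open>If \<open>\<sigma>\<close> has a last index, \<open>sub\<close> at that index concerns
  \<open>\<sigma>\<close> itself. Otherwise its length is a limit and \<open>\<sigma>\<close> is the
  union of its proper restrictions, which lie in the tree. Nonemptiness matters because
  \<open>sub\<close> says nothing about the empty sequence.\<close>

lemma limit_closed_closure:
  fixes q :: "('k::wellorder \<times> 'k) set set"
  assumes q: "is_tree q" "limit_closed q" and \<sigma>: "\<sigma> \<in> seqs" "\<sigma> \<noteq> {}"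
    and sub: "\<And>\<iota>. \<iota> \<in> Domain \<sigma> \<Longrightarrow> \<exists>\<tau>\<in>q. {z \<in> \<sigma>. fst z \<le> \<iota>} \<subseteq> \<tau>"
  shows "\<sigma> \<in> q"
proof (cases "\<exists>\<iota>\<in>Domain \<sigma>. \<forall>\<alpha>\<in>Domain \<sigma>. \<alpha> \<le> \<iota>")
  case True
  then obtain \<iota> where "\<iota> \<in> Domain \<sigma>" "\<forall>\<alpha>\<in>Domain \<sigma>. \<alpha> \<le> \<iota>" by auto
  then have "{z \<in> \<sigma>. fst z \<le> \<iota>} = \<sigma>" by auto
  with sub[OF \<open>\<iota> \<in> Domain \<sigma>\<close>] q(1) \<sigma>(1) show ?thesis unfolding is_tree_def by auto
next
  case False
  let ?s = "\<lambda>\<iota>. {z \<in> \<sigma>. fst z < \<iota>}"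
  have D: "\<And>\<alpha>. \<alpha> \<in> Domain \<sigma> \<longleftrightarrow> \<alpha> < len \<sigma>" using \<sigma>(1) by (rule seqs_Domain_iff)
  have lim: "limit_length (len \<sigma>)"
    unfolding limit_length_def
  proof
    show "\<exists>\<beta>. \<beta> < len \<sigma>"
    proof -
      obtain z where "z \<in> \<sigma>" using \<sigma>(2) by auto
      then have "fst z \<in> Domain \<sigma>" by (cases z) auto
      then show ?thesis using D by auto
    qed
    show "\<forall>\<beta><len \<sigma>. \<exists>\<gamma><len \<sigma>. \<beta> < \<gamma>"
      using False by (simp add: Ball_def Bex_def D not_le)
  qed
  have "?s \<iota> \<in> q" if "\<iota> < len \<sigma>" for \<iota>
  proof -
    have "\<exists>\<tau>\<in>q. {z \<in> \<sigma>. fst z \<le> \<iota>} \<subseteq> \<tau>" using that by (intro sub) (simp add: D)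
    then obtain \<tau> where "\<tau> \<in> q" "{z \<in> \<sigma>. fst z \<le> \<iota>} \<subseteq> \<tau>" ..
    moreover have "?s \<iota> \<subseteq> {z \<in> \<sigma>. fst z \<le> \<iota>}" by auto
    ultimately show ?thesis using q(1) seqs_restrict_less[OF \<sigma>(1)] unfolding is_tree_def by blast
  qed
  moreover have "?s \<iota> \<subseteq> ?s \<iota>'" if "\<iota> \<le> \<iota>'" for \<iota> \<iota>' using that by auto
  ultimately have "(\<Union>\<iota>\<in>{..<len \<sigma>}. ?s \<iota>) \<in> q"
    using lim by (intro q(2)[unfolded limit_closed_def, rule_format]) blast
  moreover have "(\<Union>\<iota>\<in>{..<len \<sigma>}. ?s \<iota>) = \<sigma>"
  proof
    show "\<sigma> \<subseteq> (\<Union>\<iota>\<in>{..<len \<sigma>}. ?s \<iota>)"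
    proof
      fix z assume z: "z \<in> \<sigma>"
      then have "fst z \<in> Domain \<sigma>" by (cases z) auto
      then have "fst z < len \<sigma>" using D by auto
      then obtain \<gamma> where "\<gamma> < len \<sigma>" "fst z < \<gamma>" using lim unfolding limit_length_def by blast
      with z show "z \<in> (\<Union>\<iota>\<in>{..<len \<sigma>}. ?s \<iota>)" by auto
    qed
  qed auto
  ultimately show ?thesis by simp
qed

section \<open>Regularity and a Solovay partition\<close>

locale regular_uncountable =
  fixes ty :: "'k::wellorder itself"
  assumes Card_order: "Card_order (ord_le :: 'k rel)"
    and uncountable: "natLeq <o (ord_le :: 'k rel)"
    and regular: "regularCard (ord_le :: 'k rel)"
begin

abbreviation \<kappa> :: "'k rel" where
  "\<kappa> \<equiv> ord_le"

section \<open>Regularity as the existence of bounds; sets of size less than \<kappa>\<close>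

lemma Field_ord_le: "Field \<kappa> = UNIV"
  by (auto simp: ord_le_def Field_def)

lemma ex_greater: "\<exists>\<beta>::'k. \<alpha> < \<beta>"
proof -
  have "natLeq \<le>o \<kappa>" using uncountable ordLess_imp_ordLeq by blast
  then have "\<not> finite (Field \<kappa>)"
    using Card_order cinfinite_mono natLeq_cinfinite unfolding cinfinite_def by blast
  from infinite_Card_order_limit[OF Card_order this, of \<alpha>] obtain \<beta> :: 'k where "\<alpha> \<noteq> \<beta>" "(\<alpha>, \<beta>) \<in> ord_le"
    by (auto simp: Field_ord_le)
  then show ?thesis unfolding ord_le_def by (intro exI[of _ \<beta>]) auto
qed

lemma cofinal_card:
  assumes "\<And>\<beta>::'k. \<exists>\<gamma>\<in>K. \<beta> \<le> \<gamma>" shows "|K| =o \<kappa>"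
proof -
  have "cofinal K ord_le"
    unfolding cofinal_def
  proof
    fix \<alpha> :: 'k
    obtain \<beta> :: 'k where "\<alpha> < \<beta>" using ex_greater by blast
    moreover obtain \<gamma> where "\<gamma> \<in> K" "\<beta> \<le> \<gamma>" using assms by blast
    ultimately show "\<exists>b\<in>K. \<alpha> \<noteq> b \<and> (\<alpha>, b) \<in> ord_le" unfolding ord_le_def by (intro bexI[of _ \<gamma>]) auto
  qed
  then show ?thesis using regular unfolding regularCard_def by (simp add: Field_ord_le)
qed

text \<open>The form in which regularity is used from here on: values without a strict upper bound
  would be cofinal, so \<open>A\<close> would have at least \<kappa> elements.\<close>

lemma small_bound:
  assumes "|A| <o \<kappa>" obtains \<beta> :: 'k where "\<And>a. a \<in> A \<Longrightarrow> f a < \<beta>"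
proof -
  have "\<exists>\<beta>. \<forall>a\<in>A. f a < \<beta>"
  proof (rule ccontr)
    assume "\<nexists>\<beta>. \<forall>a\<in>A. f a < \<beta>"
    then have "|f ` A| =o \<kappa>" by (intro cofinal_card) (auto simp: not_less)
    then show False
      using not_ordLess_ordIso ordLeq_ordLess_trans[OF card_of_image assms] by blast
  qed
  then show ?thesis using that by blast
qed

lemma small_subset: "|B| <o \<kappa> \<Longrightarrow> A \<subseteq> B \<Longrightarrow> |A| <o \<kappa>"
  by (rule ordLeq_ordLess_trans[OF card_of_mono1])

lemma small_image: "|A| <o \<kappa> \<Longrightarrow> |f ` A| <o \<kappa>"
  by (rule ordLeq_ordLess_trans[OF card_of_image])

lemma small_inj: "|B| <o \<kappa> \<Longrightarrow> inj_on f A \<Longrightarrow> f ` A \<subseteq> B \<Longrightarrow> |A| <o \<kappa>"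
  using card_of_ordLeq[of A B] ordLeq_ordLess_trans by blast

lemma small_lessThan: "|{..<\<alpha>::'k}| <o \<kappa>"
proof -
  have "underS ord_le \<alpha> = {..<\<alpha>}" by (auto simp: underS_def ord_le_def)
  then show ?thesis using card_of_underS[OF Card_order, of \<alpha>] by (simp add: Field_ord_le)
qed

lemma small_atMost: "|{..\<alpha>::'k}| <o \<kappa>"
proof -
  obtain \<beta> where "\<alpha> < \<beta>" using ex_greater by blast
  then show ?thesis by (intro small_subset[OF small_lessThan[of \<beta>]]) auto
qed

lemma small_nat: "|UNIV :: nat set| <o \<kappa>"
  using uncountable card_of_nat ordIso_ordLess_trans by blast

lemma small_seq: "\<sigma> \<in> seqs \<Longrightarrow> |\<sigma> :: ('k \<times> 'b) set| <o \<kappa>"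
  by (rule small_inj[OF small_lessThan[of "len \<sigma>"], of fst])
    (auto simp: inj_on_def seqs_Domain_iff[symmetric] dest: single_valuedD[OF seqs_single_valued])

text \<open>The initial segments of one sequence form a chain, so \<open>len\<close> is injective on
  them.\<close>

lemma small_initial_segments:
  assumes "\<sigma> \<in> seqs" shows "|{\<rho> \<in> (seqs :: ('k \<times> 'b) set set). \<rho> \<subseteq> \<sigma>}| <o \<kappa>"
proof (rule small_inj[OF small_atMost[of "len \<sigma>"], of len])
  show "inj_on len {\<rho> \<in> seqs. \<rho> \<subseteq> \<sigma>}"
  proof (rule inj_onI)
    fix \<rho> \<pi> assume a: "\<rho> \<in> {\<rho> \<in> seqs. \<rho> \<subseteq> \<sigma>}" "\<pi> \<in> {\<rho> \<in> seqs. \<rho> \<subseteq> \<sigma>}" "len \<rho> = len \<pi>"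
    then have "\<rho> \<subseteq> \<pi> \<or> \<pi> \<subseteq> \<rho>" using seqs_below_comparable[OF _ _ assms] by blast
    then show "\<rho> = \<pi>" using a seqs_subset_eq[of \<rho> \<pi>] seqs_subset_eq[of \<pi> \<rho>] by auto
  qed
qed (use assms in \<open>auto simp: seqs_subset_len\<close>)

text \<open>Regularity is applied twice, for \<open>\<xi>\<close> and then for
  \<open>\<gamma>\<close>. A closure point \<open>\<alpha>\<close> of \<open>g\<close> is closed
  under \<open>G \<gamma>\<close> for every \<open>\<gamma> < \<alpha>\<close>, so a single
  \<open>g\<close> encodes a diagonal intersection of clubs.\<close>

lemma bounding_function:
  fixes G :: "'k \<Rightarrow> 'k \<Rightarrow> 'k"
  obtains g where "\<And>\<gamma> \<xi> \<beta>. \<gamma> \<le> \<beta> \<Longrightarrow> \<xi> \<le> \<beta> \<Longrightarrow> G \<gamma> \<xi> < g \<beta>"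
proof -
  have "\<exists>g. \<forall>\<gamma>\<le>\<beta>. \<forall>\<xi>\<le>\<beta>. G \<gamma> \<xi> < g" for \<beta>
  proof -
    have "\<exists>m. \<forall>\<xi>\<le>\<beta>. G \<gamma> \<xi> < m" for \<gamma>
      by (rule small_bound[OF small_atMost[of \<beta>], of "G \<gamma>"]) auto
    then obtain m where m: "\<And>\<gamma> \<xi>. \<xi> \<le> \<beta> \<Longrightarrow> G \<gamma> \<xi> < m \<gamma>" by metis
    obtain g where "\<And>\<gamma>. \<gamma> \<le> \<beta> \<Longrightarrow> m \<gamma> < g"
      using small_bound[OF small_atMost[of \<beta>], of m] by auto
    then show ?thesis using m by (meson less_trans)
  qed
  then show ?thesis using that by metis
qed

section \<open>Stationary sets of ordinals of cofinality \<omega> and their partition\<close>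

definition closure_point :: "('k \<Rightarrow> 'k) \<Rightarrow> 'k \<Rightarrow> bool" where
  "closure_point g \<alpha> \<longleftrightarrow> (\<forall>\<beta><\<alpha>. g \<beta> < \<alpha>)"

text \<open>A ladder makes \<open>\<alpha>\<close> a limit ordinal of cofinality \<omega>; it need
  not be increasing.\<close>

definition ladder :: "(nat \<Rightarrow> 'k) \<Rightarrow> 'k \<Rightarrow> bool" where
  "ladder a \<alpha> \<longleftrightarrow> (\<forall>n. a n < \<alpha>) \<and> (\<forall>\<beta><\<alpha>. \<exists>n. \<beta> < a n)"

text \<open>Stationarity relative to the limit ordinals of cofinality \<open>\<omega>\<close>; the sets of closure
  points of functions are a base of the club filter.\<close>

definition stat :: "'k set \<Rightarrow> bool" where
  "stat S \<longleftrightarrow> (\<forall>g. \<exists>\<alpha>\<in>S. closure_point g \<alpha> \<and> (\<exists>a. ladder a \<alpha>))"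

lemma stat_mono: "stat S \<Longrightarrow> S \<subseteq> S' \<Longrightarrow> stat S'"
  unfolding stat_def by blast

text \<open>The orbit of a point under a function \<open>g'\<close> lying above both the identity
  and \<open>g\<close> is strictly increasing. Its supremum exists since \<kappa> has uncountable
  cofinality, and it is closed under \<open>g\<close>.\<close>

lemma stat_UNIV: "stat UNIV"
  unfolding stat_def
proof
  fix g :: "'k \<Rightarrow> 'k"
  obtain g' where g': "\<And>\<gamma> \<xi> \<beta>. \<gamma> \<le> \<beta> \<Longrightarrow> \<xi> \<le> \<beta> \<Longrightarrow> max \<gamma> (g \<xi>) < g' \<beta>"
    using bounding_function[of "\<lambda>\<gamma> \<xi>. max \<gamma> (g \<xi>)"] by blast
  \<comment> \<open>The starting point \<open>undefined\<close> is arbitrary.\<close>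
  define a where "a n = (g' ^^ n) undefined" for n
  have a: "a n < a (Suc n)" "\<And>\<xi>. \<xi> \<le> a n \<Longrightarrow> g \<xi> < a (Suc n)" for n
    using g'[of "a n" "a n"] by (auto simp: a_def)
  obtain \<beta> where \<beta>: "\<And>n. a n < \<beta>" using small_bound[OF small_nat, of a] by auto
  define \<alpha> where "\<alpha> = (LEAST \<alpha>. \<forall>n. a n < \<alpha>)"
  have l1: "a n < \<alpha>" for n unfolding \<alpha>_def by (rule LeastI2[of _ \<beta>]) (use \<beta> in auto)
  have l2: "\<exists>n. \<xi> < a n" if "\<xi> < \<alpha>" for \<xi>
    using not_less_Least[OF that[unfolded \<alpha>_def]] a(1) by (metis leI order_le_less_trans)
  have "closure_point g \<alpha>"
    unfolding closure_point_def using l1 l2 a(2) by (meson less_imp_le less_trans)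
  then show "\<exists>\<alpha>\<in>UNIV. closure_point g \<alpha> \<and> (\<exists>a. ladder a \<alpha>)"
    using l1 l2 unfolding ladder_def by blast
qed

text \<open>Solovay's argument: for some \<open>n\<close>, the \<open>n\<close>-th element of a ladder at \<open>\<alpha>\<close> is, as a function of
  \<open>\<alpha>\<close>, unbounded on stationarily many \<open>\<alpha>\<close>.\<close>

lemma ex_regressive_unbounded:
  obtains f :: "'k \<Rightarrow> 'k" where "\<And>\<alpha> a. ladder a \<alpha> \<Longrightarrow> f \<alpha> < \<alpha>" "\<And>\<beta>. stat {\<alpha>. \<beta> \<le> f \<alpha>}"
proof -
  define lad where "lad \<alpha> = (SOME a. ladder a \<alpha>)" for \<alpha> :: 'k
  have lad: "ladder (lad \<alpha>) \<alpha>" if "ladder a \<alpha>" for a \<alpha>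
    unfolding lad_def using someI[of "\<lambda>a. ladder a \<alpha>", OF that] .
  have "\<exists>n. \<forall>\<beta>. stat {\<alpha>. \<beta> \<le> lad \<alpha> n}"
  proof (rule ccontr)
    assume "\<nexists>n. \<forall>\<beta>. stat {\<alpha>. \<beta> \<le> lad \<alpha> n}"
    then have "\<exists>\<beta> g. \<forall>\<alpha>. closure_point g \<alpha> \<longrightarrow> (\<exists>a. ladder a \<alpha>) \<longrightarrow> lad \<alpha> n < \<beta>" for n
      unfolding stat_def by (metis (lifting) linorder_not_le mem_Collect_eq)
    then obtain \<beta> g where bg: "\<And>n \<alpha> a. closure_point (g n) \<alpha> \<Longrightarrow> ladder a \<alpha> \<Longrightarrow> lad \<alpha> n < \<beta> n"
      by metis
    obtain \<beta>' where \<beta>': "\<And>n. \<beta> n < \<beta>'" using small_bound[OF small_nat, of \<beta>] by auto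
    have "\<exists>m. \<forall>n. g n \<xi> < m" for \<xi> by (rule small_bound[OF small_nat, of "\<lambda>n. g n \<xi>"]) auto
    then obtain m where m: "\<And>n \<xi>. g n \<xi> < m \<xi>" by metis
    \<comment> \<open>Closure under \<open>max \<beta>' (m \<xi>)\<close> puts
      \<open>\<alpha>\<close> above \<open>\<beta>'\<close> and makes it a closure point of all
      \<open>g n\<close> at once. The whole ladder at \<open>\<alpha>\<close> is then bounded by
      \<open>\<beta>' < \<alpha>\<close>, which is absurd.\<close>
    obtain \<alpha> a where \<alpha>: "closure_point (\<lambda>\<xi>. max \<beta>' (m \<xi>)) \<alpha>" "ladder a \<alpha>"
      using stat_UNIV unfolding stat_def by blast
    have "\<beta>' < \<alpha>" using \<alpha> unfolding closure_point_def ladder_def by (metis max_less_iff_conj)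
    moreover have "closure_point (g n) \<alpha>" for n
      using \<alpha>(1) m unfolding closure_point_def by (meson less_trans max_less_iff_conj)
    then have "lad \<alpha> n < \<beta>'" for n using bg \<alpha>(2) \<beta>' by (meson less_trans)
    ultimately show False using lad[OF \<alpha>(2)] unfolding ladder_def by (meson not_less_iff_gr_or_eq)
  qed
  then obtain n where "\<And>\<beta>. stat {\<alpha>. \<beta> \<le> lad \<alpha> n}" by blast
  then show ?thesis using that[of "\<lambda>\<alpha>. lad \<alpha> n"] lad unfolding ladder_def by blast
qed

text \<open>Fodor's argument. If all fibres over \<open>\<gamma> \<ge> \<beta>\<close> were
  nonstationary, the diagonal intersection of the clubs avoiding them would still meet the
  stationary set where \<open>\<beta> \<le> f \<alpha>\<close>. As
  \<open>f \<alpha> < \<alpha>\<close>, such an \<open>\<alpha>\<close> lies in the club that avoids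
  its own fibre.\<close>

lemma ex_stat_fibres:
  obtains f :: "'k \<Rightarrow> 'k" where "\<And>\<beta>. \<exists>\<gamma>\<in>{\<gamma>. stat {\<alpha>. f \<alpha> = \<gamma>}}. \<beta> \<le> \<gamma>"
proof -
  obtain f :: "'k \<Rightarrow> 'k" where f: "\<And>\<alpha> a. ladder a \<alpha> \<Longrightarrow> f \<alpha> < \<alpha>" "\<And>\<beta>. stat {\<alpha>. \<beta> \<le> f \<alpha>}"
    using ex_regressive_unbounded by blast
  have "\<exists>\<gamma>\<ge>\<beta>. stat {\<alpha>. f \<alpha> = \<gamma>}" for \<beta>
  proof (rule ccontr)
    assume "\<not> (\<exists>\<gamma>\<ge>\<beta>. stat {\<alpha>. f \<alpha> = \<gamma>})"
    then have "\<forall>\<gamma>. \<exists>g. \<beta> \<le> \<gamma> \<longrightarrow> (\<forall>\<alpha>. closure_point g \<alpha> \<longrightarrow> (\<exists>a. ladder a \<alpha>) \<longrightarrow> f \<alpha> \<noteq> \<gamma>)"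
      unfolding stat_def by (metis (lifting) mem_Collect_eq)
    then obtain G where G: "\<And>\<gamma> \<alpha> a. \<beta> \<le> \<gamma> \<Longrightarrow> closure_point (G \<gamma>) \<alpha> \<Longrightarrow> ladder a \<alpha> \<Longrightarrow> f \<alpha> \<noteq> \<gamma>"
      by metis
    obtain g where g: "\<And>\<gamma> \<xi> \<beta>. \<gamma> \<le> \<beta> \<Longrightarrow> \<xi> \<le> \<beta> \<Longrightarrow> G \<gamma> \<xi> < g \<beta>" using bounding_function by blast
    obtain \<alpha> a where \<alpha>: "closure_point g \<alpha>" "ladder a \<alpha>" "\<beta> \<le> f \<alpha>"
      using f(2) unfolding stat_def by (metis (lifting) mem_Collect_eq)
    have "closure_point (G (f \<alpha>)) \<alpha>"
      unfolding closure_point_def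
    proof (intro allI impI)
      fix \<xi> assume "\<xi> < \<alpha>"
      then have "max (f \<alpha>) \<xi> < \<alpha>" using f(1)[OF \<alpha>(2)] by simp
      then have "g (max (f \<alpha>) \<xi>) < \<alpha>" using \<alpha>(1) unfolding closure_point_def by blast
      moreover have "G (f \<alpha>) \<xi> < g (max (f \<alpha>) \<xi>)" by (rule g) auto
      ultimately show "G (f \<alpha>) \<xi> < \<alpha>" by (rule less_trans[rotated])
    qed
    then show False using G[OF \<alpha>(3) _ \<alpha>(2)] by blast
  qed
  then show ?thesis using that[of f] by blast
qed

text \<open>Cofinally many fibres are stationary, hence \<kappa> many by regularity, and their index
  set maps onto \<open>A\<close>. Composing with this surjection can only enlarge fibres.\<close>

lemma ex_stat_decoding:
  assumes "A \<noteq> {}" "|A| \<le>o \<kappa>"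
  obtains dec :: "'k \<Rightarrow> 'b" where "\<And>t. t \<in> A \<Longrightarrow> stat {\<alpha>. dec \<alpha> = t}"
proof -
  obtain f :: "'k \<Rightarrow> 'k" where f: "\<And>\<beta>. \<exists>\<gamma>\<in>{\<gamma>. stat {\<alpha>. f \<alpha> = \<gamma>}}. \<beta> \<le> \<gamma>"
    using ex_stat_fibres by blast
  let ?G = "{\<gamma>. stat {\<alpha>. f \<alpha> = \<gamma>}}"
  have "|A| \<le>o |?G|"
    using assms(2) ordIso_symmetric[OF cofinal_card[OF f]] by (rule ordLeq_ordIso_trans)
  then obtain e where e: "e ` ?G = A" using card_of_ordLeq2[OF assms(1), of ?G] by blast
  have "stat {\<alpha>. e (f \<alpha>) = t}" if "t \<in> A" for t
  proof -
    obtain \<gamma> where \<gamma>: "stat {\<alpha>. f \<alpha> = \<gamma>}" "e \<gamma> = t" using \<open>t \<in> A\<close> unfolding e[symmetric] by blast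
    have "{\<alpha>. f \<alpha> = \<gamma>} \<subseteq> {\<alpha>. e (f \<alpha>) = t}" using \<gamma>(2) by auto
    then show ?thesis using \<gamma>(1) by (rule stat_mono[rotated])
  qed
  then show ?thesis using that[of "\<lambda>\<alpha>. e (f \<alpha>)"] by blast
qed

end

section \<open>Trees carrying a dominating function\<close>

text \<open>Here forcing is replaced by two statements about trees: \<open>unbounded\<close> says
  that nodes decide the dominating real arbitrarily far, and \<open>dominates\<close> that some
  \<open>R'\<close> fixes the point \<open>\<alpha>\<^sub>0\<close> beyond which every decided value
  is at least \<open>g\<close>. The equation \<kappa>^{<\<kappa>} = \<kappa> enters through
  \<open>code\<close>, which numbers the nodes, and \<open>dec\<close>, which attaches a stationary
  set to each element of 2^{<\<kappa>}.\<close>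

locale dominated_tree_forcing = regular_uncountable ty for ty :: "'k::wellorder itself" +
  fixes P :: "('k \<times> 'k) set set set"
    and T :: "('k \<times> 'k) set set"
    and h :: "('k \<times> 'k) set \<Rightarrow> ('k \<times> 'k) set"
    and code :: "('k \<times> 'k) set \<Rightarrow> 'k"
    and dec :: "'k \<Rightarrow> ('k \<times> bool) set"
  assumes tree_forcing: "tree_forcing P"
    and h_seqs: "\<sigma> \<in> seqs \<Longrightarrow> h \<sigma> \<in> seqs"
    and h_mono: "\<sigma> \<in> seqs \<Longrightarrow> \<tau> \<in> seqs \<Longrightarrow> \<sigma> \<subseteq> \<tau> \<Longrightarrow> h \<sigma> \<subseteq> h \<tau>"
    and code: "inj_on code seqs"
    and dec: "t \<in> seqs \<Longrightarrow> stat {\<alpha>. dec \<alpha> = t}"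
    and unbounded: "R \<in> P \<Longrightarrow> R \<subseteq> T \<Longrightarrow> \<exists>\<tau>\<in>R. \<alpha> \<in> Domain (h \<tau>)"
    and dominates: "R \<in> P \<Longrightarrow> R \<subseteq> T \<Longrightarrow> \<exists>R'\<in>P. R' \<subseteq> R \<and>
      (\<exists>\<alpha>\<^sub>0. \<forall>\<tau>\<in>R'. \<forall>\<alpha> \<beta>. (\<alpha>, \<beta>) \<in> h \<tau> \<longrightarrow> \<alpha>\<^sub>0 < \<alpha> \<longrightarrow> g \<alpha> \<le> \<beta>)"
begin

section \<open>Extending nodes inside a condition, and the game of next nodes\<close>

lemma P_tree: "R \<in> P \<Longrightarrow> is_tree R"
  and P_limit_closed: "R \<in> P \<Longrightarrow> limit_closed R"
  and P_restrict: "R \<in> P \<Longrightarrow> \<sigma> \<in> R \<Longrightarrow> tree_restrict R \<sigma> \<in> P"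
  using tree_forcing unfolding tree_forcing_def by blast+

lemma P_seqs: "R \<in> P \<Longrightarrow> \<sigma> \<in> R \<Longrightarrow> \<sigma> \<in> seqs"
  and P_down: "R \<in> P \<Longrightarrow> \<tau> \<in> R \<Longrightarrow> \<sigma> \<in> seqs \<Longrightarrow> \<sigma> \<subseteq> \<tau> \<Longrightarrow> \<sigma> \<in> R"
  using P_tree unfolding is_tree_def by blast+

lemma Domain_h_mono: "\<sigma> \<in> seqs \<Longrightarrow> \<tau> \<in> seqs \<Longrightarrow> \<sigma> \<subseteq> \<tau> \<Longrightarrow> \<alpha> \<in> Domain (h \<sigma>) \<Longrightarrow> \<alpha> \<in> Domain (h \<tau>)"
  using h_mono by blast

lemma ex_extension:
  assumes R: "R \<in> P" "R \<subseteq> T" and \<sigma>: "\<sigma> \<in> R"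
  obtains \<tau> where "\<tau> \<in> R" "\<sigma> \<subset> \<tau>" "\<alpha> \<in> Domain (h \<tau>)"
proof -
  \<comment> \<open>\<open>len (h \<sigma>)\<close> lies just outside the domain of
    \<open>h \<sigma>\<close>, so a node deciding it is not an initial segment of
    \<open>\<sigma>\<close>.\<close>
  let ?\<alpha> = "max \<alpha> (len (h \<sigma>))"
  have sub: "tree_restrict R \<sigma> \<subseteq> R" by (auto simp: tree_restrict_def)
  then obtain \<tau> where \<tau>: "\<tau> \<in> tree_restrict R \<sigma>" "?\<alpha> \<in> Domain (h \<tau>)"
    using unbounded[OF P_restrict[OF R(1) \<sigma>]] R(2) by blast
  have s: "\<sigma> \<in> seqs" "\<tau> \<in> seqs" "\<tau> \<in> R" using \<sigma> \<tau> sub R(1) P_seqs by auto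
  have "\<not> \<tau> \<subseteq> \<sigma>"
  proof
    assume "\<tau> \<subseteq> \<sigma>"
    then have "?\<alpha> \<in> Domain (h \<sigma>)" using Domain_h_mono[OF s(2,1)] \<tau>(2) by blast
    then show False using seqs_Domain[OF h_seqs[OF s(1)]] by auto
  qed
  then have "\<sigma> \<subset> \<tau>" using \<tau>(1) unfolding tree_restrict_def by auto
  moreover have "\<alpha> \<in> Domain (h \<tau>)" using seqs_down[OF h_seqs[OF s(2)] \<tau>(2)] by simp
  ultimately show ?thesis using that s by blast
qed

text \<open>Minimality makes the next node unique along each branch, so a node determines the
  earlier moves. No tree is mentioned: the notion is the same for all conditions.\<close>

definition nxt :: "('k \<times> 'k) set \<Rightarrow> ('k \<times> 'k) set set" where
  "nxt \<sigma> = {\<tau> \<in> seqs. \<sigma> \<subset> \<tau> \<and> code \<sigma> \<in> Domain (h \<tau>) \<and>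
     (\<forall>\<pi>\<in>seqs. \<sigma> \<subset> \<pi> \<and> \<pi> \<subset> \<tau> \<longrightarrow> code \<sigma> \<notin> Domain (h \<pi>))}"

lemma nxt_unique:
  assumes "\<tau> \<in> nxt \<sigma>" "\<tau>' \<in> nxt \<sigma>" "\<tau> \<subseteq> \<chi>" "\<tau>' \<subseteq> \<chi>" "\<chi> \<in> seqs" shows "\<tau> = \<tau>'"
proof -
  have "\<tau> \<subseteq> \<tau>' \<or> \<tau>' \<subseteq> \<tau>"
    using assms by (intro seqs_below_comparable[of _ _ \<chi>]) (auto simp: nxt_def)
  then show ?thesis using assms(1,2) unfolding nxt_def by blast
qed

lemma ex_nxt:
  assumes "R \<in> P" "R \<subseteq> T" "\<sigma> \<in> R"
  obtains \<tau> where "\<tau> \<in> R" "\<tau> \<in> nxt \<sigma>"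
proof -
  obtain \<tau> where \<tau>: "\<tau> \<in> R" "\<sigma> \<subset> \<tau>" "code \<sigma> \<in> Domain (h \<tau>)" using ex_extension[OF assms] by blast
  obtain \<rho> where \<rho>: "\<rho> \<in> seqs" "\<rho> \<subseteq> \<tau>" "\<sigma> \<subset> \<rho> \<and> code \<sigma> \<in> Domain (h \<rho>)"
    "\<And>\<pi>. \<pi> \<in> seqs \<Longrightarrow> \<pi> \<subset> \<rho> \<Longrightarrow> \<not> (\<sigma> \<subset> \<pi> \<and> code \<sigma> \<in> Domain (h \<pi>))"
    by (rule seqs_minimal[of \<tau> "\<lambda>\<rho>. \<sigma> \<subset> \<rho> \<and> code \<sigma> \<in> Domain (h \<rho>)"]) (use \<tau> assms(1) P_seqs in auto)
  have "\<rho> \<in> R" using P_down[OF assms(1) \<tau>(1) \<rho>(1,2)] .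
  moreover have "\<rho> \<in> nxt \<sigma>" unfolding nxt_def using \<rho> by blast
  ultimately show ?thesis using that by blast
qed

text \<open>A game of length \<open>\<omega>\<close>: one player picks a bound at the current node, the other moves in \<open>R\<close> to a
  next node at which \<open>h\<close> exceeds the bound, and loses when this is impossible.  As a node determines
  the play leading to it, strategies for the first player are functions of the current node.\<close>

definition run :: "('k \<times> 'k) set set \<Rightarrow> (('k \<times> 'k) set \<Rightarrow> 'k) \<Rightarrow> (nat \<Rightarrow> ('k \<times> 'k) set) \<Rightarrow> bool" where
  "run R \<phi> s \<longleftrightarrow> (\<forall>n. s (Suc n) \<in> R \<and> s (Suc n) \<in> nxt (s n) \<and>
     (\<exists>b>\<phi> (s n). (code (s n), b) \<in> h (s (Suc n))))"

text \<open>The loser is the second player, who extends the nodes.\<close>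

definition losing :: "('k \<times> 'k) set set \<Rightarrow> ('k \<times> 'k) set \<Rightarrow> bool" where
  "losing R \<sigma> \<longleftrightarrow> (\<exists>\<phi>. \<forall>s. s 0 = \<sigma> \<longrightarrow> \<not> run R \<phi> s)"

lemma nxt_chain_mono:
  assumes "\<And>n. s (Suc n) \<in> nxt (s n)" "m \<le> n" shows "s m \<subseteq> s n"
  using assms(2)
proof (rule lift_Suc_mono_le[of s, rotated])
  fix n show "s n \<subseteq> s (Suc n)" using assms(1)[of n] unfolding nxt_def by auto
qed

text \<open>Open determinacy: winning answers to all moves of the second player combine into one strategy.\<close>

lemma not_losing_step:
  assumes "\<not> losing R \<rho>"
  shows "\<exists>\<tau>\<in>R. \<tau> \<in> nxt \<rho> \<and> (\<exists>b>\<beta>. (code \<rho>, b) \<in> h \<tau>) \<and> \<not> losing R \<tau>"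
proof (rule ccontr)
  assume neg: "\<not> ?thesis"
  define \<Phi> where "\<Phi> \<tau> = (SOME \<phi>. \<forall>s. s 0 = \<tau> \<longrightarrow> \<not> run R \<phi> s)" for \<tau>
  have \<Phi>: "\<not> run R (\<Phi> \<tau>) s" if "losing R \<tau>" "s 0 = \<tau>" for \<tau> s
    using someI_ex[OF that(1)[unfolded losing_def]] that(2) unfolding \<Phi>_def by blast
  \<comment> \<open>The combined strategy names \<open>\<beta>\<close> at \<open>\<rho>\<close> and
    afterwards follows the strategy belonging to the first move \<open>\<tau>\<close>, which is
    recovered from the current node \<open>\<chi>\<close> by uniqueness of next nodes.\<close>
  define \<phi> where "\<phi> \<chi> = (if \<chi> = \<rho> then \<beta> else \<Phi> (THE \<tau>. \<tau> \<in> nxt \<rho> \<and> \<tau> \<subseteq> \<chi>) \<chi>)" for \<chi>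
  obtain s where s: "s 0 = \<rho>" "run R \<phi> s" using assms unfolding losing_def by blast
  have nx: "s (Suc n) \<in> nxt (s n)" for n using s(2) unfolding run_def by blast
  have 1: "s 1 \<in> R" "s 1 \<in> nxt \<rho>" "\<exists>b>\<phi> \<rho>. (code \<rho>, b) \<in> h (s 1)"
    using s(2)[unfolded run_def, rule_format, of 0] s(1) by auto
  then have los: "losing R (s 1)" using neg unfolding \<phi>_def by auto
  have \<phi>: "\<phi> (s (Suc n)) = \<Phi> (s 1) (s (Suc n))" for n
  proof -
    have sub: "s 1 \<subseteq> s (Suc n)" by (rule nxt_chain_mono[of s, OF nx]) auto
    moreover have "\<rho> \<subset> s 1" using 1 unfolding nxt_def by auto
    ultimately have "s (Suc n) \<noteq> \<rho>" by auto
    moreover have sq: "s (Suc n) \<in> seqs" using nx[of n] unfolding nxt_def by auto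
    have "(THE \<tau>. \<tau> \<in> nxt \<rho> \<and> \<tau> \<subseteq> s (Suc n)) = s 1"
    proof (rule the_equality)
      show "s 1 \<in> nxt \<rho> \<and> s 1 \<subseteq> s (Suc n)" using 1(2) sub by blast
      show "\<tau> = s 1" if "\<tau> \<in> nxt \<rho> \<and> \<tau> \<subseteq> s (Suc n)" for \<tau>
        using nxt_unique[OF _ 1(2) _ sub sq] that by blast
    qed
    ultimately show ?thesis unfolding \<phi>_def by simp
  qed
  have "run R (\<Phi> (s 1)) (\<lambda>n. s (Suc n))"
    using s(2) unfolding run_def by (metis \<phi>)
  then show False using \<Phi>[OF los] by simp
qed

text \<open>A node has fewer than \<kappa> initial segments, so the strategies attached to all of
  them are bounded by one function of the node.\<close>

lemma ex_bound_strategies: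
  fixes \<Phi> :: "('k \<times> 'k) set \<Rightarrow> ('k \<times> 'k) set \<Rightarrow> 'k"
  obtains m where "\<And>\<chi> \<rho>. \<chi> \<in> seqs \<Longrightarrow> \<rho> \<in> seqs \<Longrightarrow> \<rho> \<subseteq> \<chi> \<Longrightarrow> \<Phi> \<rho> \<chi> < m \<chi>"
proof -
  have "\<exists>m. \<chi> \<in> seqs \<longrightarrow> (\<forall>\<rho>\<in>seqs. \<rho> \<subseteq> \<chi> \<longrightarrow> \<Phi> \<rho> \<chi> < m)" for \<chi>
  proof (cases "\<chi> \<in> seqs")
    case True
    show ?thesis
      by (rule small_bound[OF small_initial_segments[OF True], of "\<lambda>\<rho>. \<Phi> \<rho> \<chi>"]) blast
  qed auto
  then show ?thesis using that by metis
qed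

text \<open>Let \<open>m\<close> bound all winning strategies of the first player. Domination of
  \<open>m\<close>, transported to ordinals by \<open>code\<close>, yields \<open>R'\<close> in
  which, far enough up, every chain of next nodes beats every such strategy. The game itself is
  still the one on \<open>R\<close>.\<close>

lemma ex_not_losing:
  assumes R: "R \<in> P" "R \<subseteq> T"
  obtains R' \<rho> where "R' \<in> P" "R' \<subseteq> R" "\<rho> \<in> R'" "\<And>\<tau>. \<tau> \<in> R' \<Longrightarrow> \<rho> \<subseteq> \<tau> \<Longrightarrow> \<not> losing R \<tau>"
proof -
  define \<Phi> where "\<Phi> \<tau> = (SOME \<phi>. \<forall>s. s 0 = \<tau> \<longrightarrow> \<not> run R \<phi> s)" for \<tau>
  have \<Phi>: "\<not> run R (\<Phi> \<tau>) s" if "losing R \<tau>" "s 0 = \<tau>" for \<tau> s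
    using someI_ex[OF that(1)[unfolded losing_def]] that(2) unfolding \<Phi>_def by blast
  obtain m where m: "\<And>\<chi> \<rho>. \<chi> \<in> seqs \<Longrightarrow> \<rho> \<in> seqs \<Longrightarrow> \<rho> \<subseteq> \<chi> \<Longrightarrow> \<Phi> \<rho> \<chi> < m \<chi>"
    using ex_bound_strategies by blast
  obtain R' \<alpha>\<^sub>0 where R': "R' \<in> P" "R' \<subseteq> R"
    and dom: "\<And>\<tau> \<alpha> \<beta>. \<tau> \<in> R' \<Longrightarrow> (\<alpha>, \<beta>) \<in> h \<tau> \<Longrightarrow> \<alpha>\<^sub>0 < \<alpha> \<Longrightarrow> m (inv_into seqs code \<alpha>) \<le> \<beta>"
    using dominates[OF R, of "\<lambda>\<alpha>. m (inv_into seqs code \<alpha>)"] by blast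
  \<comment> \<open>Fewer than \<kappa> nodes have a code that is too small for domination to apply.
    The domains of \<open>h\<close> at these are bounded by \<open>\<delta>\<close>, so all nodes
    above a \<open>\<rho>\<close> that decides \<open>\<delta>\<close> have large codes.\<close>
  have "|{\<sigma> \<in> seqs. code \<sigma> \<le> \<alpha>\<^sub>0}| <o \<kappa>"
    by (rule small_inj[OF small_atMost[of \<alpha>\<^sub>0], of code]) (auto intro: inj_on_subset[OF code])
  then obtain \<delta> where \<delta>: "\<And>\<sigma>. \<sigma> \<in> {\<sigma> \<in> seqs. code \<sigma> \<le> \<alpha>\<^sub>0} \<Longrightarrow> len (h \<sigma>) < \<delta>"
    using small_bound[of _ "\<lambda>\<sigma>. len (h \<sigma>)"] by blast
  have R'T: "R' \<subseteq> T" using R' R by blast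
  obtain \<rho> where \<rho>: "\<rho> \<in> R'" "\<delta> \<in> Domain (h \<rho>)" using unbounded[OF R'(1) R'T] by blast
  have big: "\<alpha>\<^sub>0 < code \<chi>" if "\<chi> \<in> R'" "\<rho> \<subseteq> \<chi>" for \<chi>
  proof (rule ccontr)
    assume "\<not> \<alpha>\<^sub>0 < code \<chi>"
    moreover have s: "\<chi> \<in> seqs" "\<rho> \<in> seqs" using that(1) \<rho>(1) P_seqs[OF R'(1)] by auto
    ultimately have "len (h \<chi>) < \<delta>" using \<delta>[of \<chi>] by simp
    moreover have "\<delta> < len (h \<chi>)"
      using Domain_h_mono[OF s(2,1) that(2) \<rho>(2)] seqs_Domain[OF h_seqs[OF s(1)]] by simp
    ultimately show False by simp
  qed
  show ?thesis
  proof (rule that[OF R' \<rho>(1)])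
    fix \<tau> assume \<tau>: "\<tau> \<in> R'" "\<rho> \<subseteq> \<tau>"
    \<comment> \<open>Any chain of next nodes in \<open>R'\<close> will do: domination makes the
      decided values large enough.\<close>
    have "\<exists>s. \<forall>n. (s n \<in> R' \<and> (n = 0 \<longrightarrow> s n = \<tau>)) \<and> s (Suc n) \<in> nxt (s n)"
    proof (rule dependent_nat_choice)
      fix \<chi> :: "('k \<times> 'k) set" and n :: nat
      assume "\<chi> \<in> R' \<and> (n = 0 \<longrightarrow> \<chi> = \<tau>)"
      then show "\<exists>\<chi>'. (\<chi>' \<in> R' \<and> (Suc n = 0 \<longrightarrow> \<chi>' = \<tau>)) \<and> \<chi>' \<in> nxt \<chi>"
        using ex_nxt[OF R'(1) R'T, of \<chi>] by blast
    qed (use \<tau> in auto)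
    then obtain s where s: "\<And>n. s n \<in> R'" "s 0 = \<tau>" "\<And>n. s (Suc n) \<in> nxt (s n)" by blast
    have "\<exists>b>\<Phi> \<tau> (s n). (code (s n), b) \<in> h (s (Suc n))" for n
    proof -
      have sub: "\<tau> \<subseteq> s n" using nxt_chain_mono[of s 0 n, OF s(3)] s(2) by simp
      have "code (s n) \<in> Domain (h (s (Suc n)))" using s(3)[of n] unfolding nxt_def by blast
      then obtain b where b: "(code (s n), b) \<in> h (s (Suc n))" by blast
      have sn: "s n \<in> seqs" "\<tau> \<in> seqs" using s(1) \<tau>(1) P_seqs[OF R'(1)] by auto
      have "\<Phi> \<tau> (s n) < m (s n)" by (rule m[OF sn sub])
      also have "m (s n) = m (inv_into seqs code (code (s n)))" using code sn by simp
      also have "\<dots> \<le> b" using dom[OF s(1) b] big[OF s(1)] sub \<tau>(2) by auto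
      finally show ?thesis using b by blast
    qed
    then have "run R (\<Phi> \<tau>) s" unfolding run_def using s R'(2) by blast
    then show "\<not> losing R \<tau>" using \<Phi>[of \<tau> s] s(2) by blast
  qed
qed

section \<open>Milestones along a sequence\<close>

text \<open>Along any sequence the milestones are enumerated increasingly: \<open>\<sigma>\<^sub>0 = {}\<close>, \<open>\<sigma>\<^bsub>\<xi>+1\<^esub>\<close> is the element of
  \<open>nxt \<sigma>\<^sub>\<xi>\<close>, and unions are taken at limits.\<close>

definition admissible :: "('k \<times> 'k) set \<Rightarrow> ('k \<times> 'k) set set \<Rightarrow> bool" where
  "admissible \<tau> M \<longleftrightarrow> (\<forall>\<rho>\<in>M. \<rho> \<subset> \<tau> \<and> code \<rho> \<in> Domain (h \<tau>))"

context
  notes conj_cong [fundef_cong]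
begin

text \<open>A milestone is minimal among the sequences admissible for the milestones strictly below
  it, so the recursion runs along proper initial segments. The conjuncts in \<open>M\<close> guard
  the recursive call, and \<open>conj_cong\<close> hands them to the termination proof.\<close>

function milestone :: "('k \<times> 'k) set \<Rightarrow> bool" where
  "milestone \<sigma> \<longleftrightarrow> (let M = {\<rho>. \<rho> \<in> seqs \<and> \<sigma> \<in> seqs \<and> \<rho> \<subset> \<sigma> \<and> milestone \<rho>} in
     \<sigma> \<in> seqs \<and> admissible \<sigma> M \<and> (\<forall>\<tau>\<in>seqs. \<tau> \<subset> \<sigma> \<longrightarrow> \<not> admissible \<tau> M))"
  by auto

termination
  by (relation "{(\<rho>, \<sigma>). \<rho> \<in> seqs \<and> \<sigma> \<in> seqs \<and> \<rho> \<subset> \<sigma>}") (use wf_seqs_psubset in auto)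

end

declare milestone.simps [simp del]

abbreviation milestones_below :: "('k \<times> 'k) set \<Rightarrow> ('k \<times> 'k) set set" where
  "milestones_below \<sigma> \<equiv> {\<rho>. \<rho> \<subset> \<sigma> \<and> milestone \<rho>}"

lemma milestone_seqs: "milestone \<sigma> \<Longrightarrow> \<sigma> \<in> seqs"
  by (subst (asm) milestone.simps) (simp add: Let_def)

lemma milestone_iff:
  "milestone \<sigma> \<longleftrightarrow> \<sigma> \<in> seqs \<and> admissible \<sigma> (milestones_below \<sigma>) \<and>
     (\<forall>\<tau>\<in>seqs. \<tau> \<subset> \<sigma> \<longrightarrow> \<not> admissible \<tau> (milestones_below \<sigma>))"
proof (cases "\<sigma> \<in> seqs")
  case True
  then have "{\<rho>. \<rho> \<in> seqs \<and> \<sigma> \<in> seqs \<and> \<rho> \<subset> \<sigma> \<and> milestone \<rho>} = milestones_below \<sigma>"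
    using milestone_seqs by auto
  then show ?thesis by (subst milestone.simps) (simp add: Let_def)
next
  case False
  then show ?thesis using milestone_seqs by blast
qed

lemma milestone_admissible: "milestone \<sigma> \<Longrightarrow> admissible \<sigma> (milestones_below \<sigma>)"
  by (simp add: milestone_iff[of \<sigma>])

lemma milestoneI:
  "admissible \<sigma> (milestones_below \<sigma>) \<Longrightarrow>
    (\<And>\<tau>. \<tau> \<in> seqs \<Longrightarrow> \<tau> \<subset> \<sigma> \<Longrightarrow> \<not> admissible \<tau> (milestones_below \<sigma>)) \<Longrightarrow> \<sigma> \<in> seqs \<Longrightarrow> milestone \<sigma>"
  by (simp add: milestone_iff[of \<sigma>])

text \<open>A milestone above \<open>\<sigma>\<close> must decide \<open>code \<sigma>\<close>, and
  \<open>\<tau>\<close> is minimal with this property.\<close>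

lemma no_milestone_between:
  assumes "milestone \<sigma>" "milestone \<pi>" "\<tau> \<in> nxt \<sigma>" "\<sigma> \<subset> \<pi>" "\<pi> \<subset> \<tau>" shows False
proof -
  have "code \<sigma> \<in> Domain (h \<pi>)" 
    using milestone_admissible[OF assms(2)] assms(1,4) unfolding admissible_def by blast
  then show False using assms milestone_seqs[OF assms(2)] unfolding nxt_def by blast
qed

text \<open>Successor step: as no milestone lies strictly between, those below \<open>\<tau>\<close>
  are \<open>\<sigma>\<close> and those below \<open>\<sigma>\<close>, and admissibility for them
  comes down to deciding \<open>code \<sigma>\<close>.\<close>

lemma milestone_nxt:
  assumes "milestone \<sigma>" "\<tau> \<in> nxt \<sigma>" shows "milestone \<tau>"
proof -
  have t: "\<tau> \<in> seqs" "\<sigma> \<subset> \<tau>" "code \<sigma> \<in> Domain (h \<tau>)" using assms(2) unfolding nxt_def by auto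
  have s: "\<sigma> \<in> seqs" using assms(1) by (rule milestone_seqs)
  have below: "\<rho> \<subseteq> \<sigma>" if "milestone \<rho>" "\<rho> \<subset> \<tau>" for \<rho>
  proof -
    have "\<rho> \<subseteq> \<sigma> \<or> \<sigma> \<subseteq> \<rho>"
      by (rule seqs_below_comparable[OF milestone_seqs[OF that(1)] s t(1)]) (use that t(2) in auto)
    moreover have "\<not> \<sigma> \<subset> \<rho>" using no_milestone_between[OF assms(1) that(1) assms(2)] that(2) by blast
    ultimately show ?thesis by blast
  qed
  have "admissible \<tau> (milestones_below \<tau>)"
    unfolding admissible_def
  proof (intro ballI conjI)
    fix \<rho> assume \<rho>: "\<rho> \<in> milestones_below \<tau>"
    then show "\<rho> \<subset> \<tau>" by simp
    have "\<rho> \<subseteq> \<sigma>" using \<rho> below by blast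
    show "code \<rho> \<in> Domain (h \<tau>)"
    proof (cases "\<rho> = \<sigma>")
      case False
      then have "\<rho> \<in> milestones_below \<sigma>" using \<rho> \<open>\<rho> \<subseteq> \<sigma>\<close> by blast
      then have "code \<rho> \<in> Domain (h \<sigma>)" using milestone_admissible[OF assms(1)] unfolding admissible_def by blast
      then show ?thesis using Domain_h_mono[OF s t(1)] t(2) by blast
    qed (use t in simp)
  qed
  moreover have "\<not> admissible \<pi> (milestones_below \<tau>)" if "\<pi> \<in> seqs" "\<pi> \<subset> \<tau>" for \<pi>
  proof
    assume "admissible \<pi> (milestones_below \<tau>)"
    then have "\<sigma> \<subset> \<pi> \<and> code \<sigma> \<in> Domain (h \<pi>)" using assms(1) t(2) unfolding admissible_def by blast
    then show False using that assms(2) unfolding nxt_def by blast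
  qed
  ultimately show ?thesis using t(1) by (intro milestoneI)
qed

lemma below_chain_Union:
  assumes s: "\<And>n. s n \<in> seqs" "(\<Union>n. s n) \<in> seqs" "\<rho> \<in> seqs" "\<rho> \<subset> (\<Union>n. s n)"
  obtains n where "\<rho> \<subseteq> s n"
proof -
  have "\<exists>n. \<not> s n \<subseteq> \<rho>" using s(4) by blast
  then obtain n where "\<not> s n \<subseteq> \<rho>" ..
  moreover have "\<rho> \<subseteq> s n \<or> s n \<subseteq> \<rho>"
    by (rule seqs_below_comparable[OF s(3) s(1) s(2)]) (use s(4) in auto)
  ultimately show ?thesis using that by blast
qed

text \<open>Limit step: a sequence admissible for the milestones below the union properly extends
  every \<open>s n\<close>, so it is no proper initial segment of the union.\<close>

lemma milestone_Union:
  assumes s: "\<And>n. milestone (s n)" "\<And>n. s n \<subset> s (Suc n)" "(\<Union>n. s n) \<in> seqs"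
  shows "milestone (\<Union>n. s n)"
proof -
  let ?L = "\<Union>n. s n"
  have sn: "s n \<in> seqs" for n using s(1) by (rule milestone_seqs)
  have lt: "s n \<subset> ?L" for n using s(2)[of n] by blast
  have "admissible ?L (milestones_below ?L)"
    unfolding admissible_def
  proof (intro ballI conjI)
    fix \<rho> assume \<rho>: "\<rho> \<in> milestones_below ?L"
    then show "\<rho> \<subset> ?L" by simp
    obtain n where "\<rho> \<subseteq> s n"
      using below_chain_Union[of s \<rho>, OF sn s(3)] \<rho> milestone_seqs by blast
    then have "\<rho> \<subset> s (Suc n)" using s(2)[of n] by blast
    then have "code \<rho> \<in> Domain (h (s (Suc n)))"
      using milestone_admissible[OF s(1), of "Suc n"] \<rho> unfolding admissible_def by blast
    then show "code \<rho> \<in> Domain (h ?L)" by (rule Domain_h_mono[OF sn s(3), rotated]) blast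
  qed
  moreover have "\<not> admissible \<pi> (milestones_below ?L)" if \<pi>: "\<pi> \<in> seqs" "\<pi> \<subset> ?L" for \<pi>
  proof
    assume a: "admissible \<pi> (milestones_below ?L)"
    obtain n where "\<pi> \<subseteq> s n" by (rule below_chain_Union[of s, OF sn s(3) \<pi>])
    moreover have "s n \<subset> \<pi>" using a lt[of n] s(1)[of n] unfolding admissible_def by blast
    ultimately show False by blast
  qed
  ultimately show ?thesis using s(3) by (intro milestoneI)
qed

text \<open>Let \<open>\<tau>\<close> be the shortest initial segment, of a long enough extension of
  \<open>\<rho>\<close> in \<open>R\<close>, that is admissible for the milestones below
  \<open>\<rho>\<close>. Either \<open>\<tau> = \<rho>\<close>, or \<open>\<tau>\<close> extends
  \<open>\<rho>\<close> and is itself a milestone unless another milestone lies between them, which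
  then serves.\<close>

lemma ex_milestone_above:
  assumes R: "R \<in> P" "R \<subseteq> T" and \<rho>: "\<rho> \<in> R"
  obtains \<tau> where "\<tau> \<in> R" "\<rho> \<subseteq> \<tau>" "milestone \<tau>"
proof -
  let ?M = "milestones_below \<rho>"
  have rs: "\<rho> \<in> seqs" using P_seqs R(1) \<rho> .
  have "|?M| <o \<kappa>"
    by (rule small_subset[OF small_initial_segments[OF rs]]) (auto dest: milestone_seqs)
  then obtain \<delta> where \<delta>: "\<And>\<sigma>. \<sigma> \<in> ?M \<Longrightarrow> code \<sigma> < \<delta>" using small_bound[of ?M code] by blast
  obtain \<chi> where \<chi>: "\<chi> \<in> R" "\<rho> \<subset> \<chi>" "\<delta> \<in> Domain (h \<chi>)" using ex_extension[OF R \<rho>] by blast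
  have cs: "\<chi> \<in> seqs" using P_seqs R(1) \<chi>(1) .
  have "admissible \<chi> ?M"
    unfolding admissible_def
    using \<chi> \<delta> seqs_down[OF h_seqs[OF cs] \<chi>(3)] by (auto dest: less_imp_le)
  then obtain \<tau> where \<tau>: "\<tau> \<in> seqs" "\<tau> \<subseteq> \<chi>" "admissible \<tau> ?M"
    "\<And>\<pi>. \<pi> \<in> seqs \<Longrightarrow> \<pi> \<subset> \<tau> \<Longrightarrow> \<not> admissible \<pi> ?M"
    using seqs_minimal[OF cs, of "\<lambda>\<tau>. admissible \<tau> ?M"] by blast
  have tR: "\<tau> \<in> R" by (rule P_down[OF R(1) \<chi>(1) \<tau>(1,2)])
  have mil: "milestone \<tau>" if "milestones_below \<tau> = ?M"
    by (rule milestoneI) (use \<tau> that in \<open>auto simp only:\<close>)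
  have M\<tau>: "?M \<subseteq> milestones_below \<tau>" using \<tau>(3) unfolding admissible_def by blast
  have "\<tau> \<subseteq> \<rho> \<or> \<rho> \<subseteq> \<tau>"
    by (rule seqs_below_comparable[OF \<tau>(1) rs cs \<tau>(2)]) (use \<chi>(2) in auto)
  then show ?thesis
  proof
    assume sub: "\<tau> \<subseteq> \<rho>"
    then have "milestone \<tau>" using M\<tau> by (intro mil) blast
    moreover have "\<tau> \<notin> ?M" using \<tau>(3) unfolding admissible_def by blast
    ultimately have "\<tau> = \<rho>" using sub by blast
    then show ?thesis using that[OF tR] \<open>milestone \<tau>\<close> by blast
  next
    assume sub: "\<rho> \<subseteq> \<tau>"
    show ?thesis
    proof (cases "milestones_below \<tau> = ?M")
      case True
      then show ?thesis using that[OF tR sub mil] by blast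
    next
      case False
      then obtain \<pi> where \<pi>: "milestone \<pi>" "\<pi> \<subset> \<tau>" "\<not> \<pi> \<subset> \<rho>" using M\<tau> by blast
      have ps: "\<pi> \<in> seqs" using \<pi>(1) by (rule milestone_seqs)
      have "\<rho> \<subseteq> \<pi>" using seqs_below_comparable[OF ps rs \<tau>(1)] \<pi> sub by blast
      moreover have "\<pi> \<in> R" using P_down[OF R(1) tR ps] \<pi>(2) by blast
      ultimately show ?thesis using that \<pi>(1) by blast
    qed
  qed
qed

section \<open>Reading a binary sequence off the limit milestones\<close>

definition limit_milestone :: "('k \<times> 'k) set \<Rightarrow> bool" where
  "limit_milestone \<sigma> \<longleftrightarrow> milestone \<sigma> \<and>
     (\<forall>\<rho>. milestone \<rho> \<and> \<rho> \<subset> \<sigma> \<longrightarrow> (\<exists>\<pi>. milestone \<pi> \<and> \<rho> \<subset> \<pi> \<and> \<pi> \<subset> \<sigma>))"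

text \<open>Only proper initial segments count, because \<open>h\<close> need not be continuous at unions.\<close>

definition value_sup :: "('k \<times> 'k) set \<Rightarrow> 'k" where
  "value_sup \<sigma> = (LEAST \<beta>. \<forall>\<rho>\<in>seqs. \<rho> \<subset> \<sigma> \<longrightarrow> (\<forall>b\<in>Range (h \<rho>). b \<le> \<beta>))"

text \<open>The guard makes the part read so far only grow and remain a sequence, whatever ordinal
  is decoded. At milestones that are not limits, or if the decoded \<open>t\<close> does not extend
  \<open>u\<close>, nothing is added.\<close>

definition read :: "('k \<times> 'k) set \<Rightarrow> ('k \<times> bool) set \<Rightarrow> ('k \<times> bool) set" where
  "read \<sigma> u = (let t = dec (value_sup \<sigma>) in
     if limit_milestone \<sigma> \<and> t \<in> seqs \<and> u \<subseteq> t then t else u)"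

function cohen_part :: "('k \<times> 'k) set \<Rightarrow> ('k \<times> bool) set" where
  "cohen_part \<sigma> = read \<sigma> (\<Union>(cohen_part ` {\<rho>. \<rho> \<in> seqs \<and> \<sigma> \<in> seqs \<and> \<rho> \<subset> \<sigma>}))"
  by auto

termination
  by (relation "{(\<rho>, \<sigma>). \<rho> \<in> seqs \<and> \<sigma> \<in> seqs \<and> \<rho> \<subset> \<sigma>}") (use wf_seqs_psubset in auto)

declare cohen_part.simps [simp del]

lemma cohen_part_eq:
  "\<sigma> \<in> seqs \<Longrightarrow> cohen_part \<sigma> = read \<sigma> (\<Union>(cohen_part ` {\<rho> \<in> seqs. \<rho> \<subset> \<sigma>}))"
  by (subst cohen_part.simps) simp

lemma read_extends: "u \<subseteq> read \<sigma> u"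
  unfolding read_def Let_def by auto

lemma cohen_part_mono:
  assumes "\<rho> \<in> seqs" "\<sigma> \<in> seqs" "\<rho> \<subseteq> \<sigma>" shows "cohen_part \<rho> \<subseteq> cohen_part \<sigma>"
proof (cases "\<rho> = \<sigma>")
  case False
  have "cohen_part \<rho> \<subseteq> \<Union>(cohen_part ` {\<rho> \<in> seqs. \<rho> \<subset> \<sigma>})" using assms False by blast
  also have "\<dots> \<subseteq> cohen_part \<sigma>" unfolding cohen_part_eq[OF assms(2)] by (rule read_extends)
  finally show ?thesis .
qed simp

lemma cohen_part_seqs:
  assumes "\<sigma> \<in> seqs" shows "cohen_part \<sigma> \<in> seqs"
  using wf_seqs_psubset assms
proof (induction \<sigma> rule: wf_induct_rule)
  case (less \<sigma>)
  let ?X = "{\<rho> \<in> seqs. \<rho> \<subset> \<sigma>}"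
  have "|?X| <o \<kappa>"
    by (rule small_subset[OF small_initial_segments[OF less.prems]]) auto
  then obtain \<beta> where \<beta>: "\<And>\<rho>. \<rho> \<in> ?X \<Longrightarrow> len (cohen_part \<rho>) < \<beta>"
    using small_bound[of ?X "\<lambda>\<rho>. len (cohen_part \<rho>)"] by blast
  have "\<Union>(cohen_part ` ?X) \<in> seqs"
  proof (rule seqs_Union)
    show "cohen_part ` ?X \<subseteq> seqs" using less by auto
    fix a b assume "a \<in> cohen_part ` ?X" "b \<in> cohen_part ` ?X"
    then obtain \<rho> \<pi> where "\<rho> \<in> ?X" "\<pi> \<in> ?X" "a = cohen_part \<rho>" "b = cohen_part \<pi>" by blast
    then show "a \<subseteq> b \<or> b \<subseteq> a"
      using seqs_below_comparable[of \<rho> \<pi> \<sigma>] less.prems cohen_part_mono[of \<rho> \<pi>] cohen_part_mono[of \<pi> \<rho>]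
      by auto
  next
    fix a assume "a \<in> cohen_part ` ?X"
    then show "len a \<le> \<beta>" using \<beta> by (auto intro: less_imp_le)
  qed
  then show ?case unfolding cohen_part_eq[OF less.prems] read_def Let_def by simp
qed

section \<open>Meeting a dense set by one play of length \<omega>\<close>

lemma ex_node_bound:
  obtains m where "\<And>\<chi> b. \<chi> \<in> seqs \<Longrightarrow> b \<in> Range (h \<chi>) \<Longrightarrow> b < m \<chi>" "\<And>\<chi>. code \<chi> < m \<chi>"
proof -
  have "\<exists>m. (\<chi> \<in> seqs \<longrightarrow> (\<forall>b\<in>Range (h \<chi>). b < m)) \<and> code \<chi> < m" for \<chi>
  proof (cases "\<chi> \<in> seqs")
    case True
    obtain \<beta> where \<beta>: "\<And>z. z \<in> h \<chi> \<Longrightarrow> snd z < \<beta>" using small_bound[OF small_seq[OF h_seqs[OF True]], of snd] by blast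
    obtain \<gamma> where "max \<beta> (code \<chi>) < \<gamma>" using ex_greater by blast
    then show ?thesis using \<beta> by (intro exI[of _ \<gamma>]) (fastforce dest: less_trans)
  qed (use ex_greater in auto)
  then show ?thesis using that by metis
qed

text \<open>Extend \<open>cohen_part \<rho>\<close> at a non-losing milestone \<open>\<rho>\<close>
  to some \<open>t \<in> D\<close>, and pick a suitable closure point \<open>\<alpha>\<close> of
  cofinality \<omega> with \<open>dec \<alpha> = t\<close>. A play along a ladder at
  \<open>\<alpha>\<close> has a limit \<open>L\<close> with \<open>value_sup L = \<alpha>\<close>,
  where exactly \<open>t\<close> is read.\<close>

lemma cohen_part_hits:
  assumes R: "R \<in> P" "R \<subseteq> T" and D: "D \<subseteq> seqs" "\<And>t. t \<in> seqs \<Longrightarrow> \<exists>t'\<in>D. t \<subseteq> t'"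
  shows "\<exists>\<sigma>\<in>R. cohen_part \<sigma> \<in> D"
proof -
  obtain R' \<rho>\<^sub>0 where R': "R' \<in> P" "R' \<subseteq> R" "\<rho>\<^sub>0 \<in> R'" "\<And>\<tau>. \<tau> \<in> R' \<Longrightarrow> \<rho>\<^sub>0 \<subseteq> \<tau> \<Longrightarrow> \<not> losing R \<tau>"
    using ex_not_losing[OF R] by blast
  obtain \<rho> where "\<rho> \<in> R'" "\<rho>\<^sub>0 \<subseteq> \<rho>" "milestone \<rho>"
    using ex_milestone_above[OF R'(1) _ R'(3)] R'(2) R(2) by blast
  \<comment> \<open>Only membership in \<open>R\<close> is retained, because the answers supplied by
    \<open>not_losing_step\<close> lie in \<open>R\<close> rather than in \<open>R'\<close>.\<close>
  define X where "X = {\<tau> \<in> R. milestone \<tau> \<and> \<not> losing R \<tau>}"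
  have \<rho>: "\<rho> \<in> X" unfolding X_def using \<open>\<rho> \<in> R'\<close> \<open>\<rho>\<^sub>0 \<subseteq> \<rho>\<close> \<open>milestone \<rho>\<close> R' by blast
  have X_seqs: "\<tau> \<in> seqs" if "\<tau> \<in> X" for \<tau> using that milestone_seqs unfolding X_def by blast
  have "\<exists>\<tau>'. \<tau> \<in> X \<longrightarrow> \<tau>' \<in> X \<and> \<tau>' \<in> nxt \<tau> \<and> (\<exists>b\<in>Range (h \<tau>'). \<beta> < b)" for \<tau> \<beta>
    using not_losing_step[of R \<tau> \<beta>] milestone_nxt[of \<tau>] unfolding X_def by blast
  then obtain nx where nx: "\<And>\<tau> \<beta>. \<tau> \<in> X \<Longrightarrow> nx \<tau> \<beta> \<in> X" "\<And>\<tau> \<beta>. \<tau> \<in> X \<Longrightarrow> nx \<tau> \<beta> \<in> nxt \<tau>"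
    "\<And>\<tau> \<beta>. \<tau> \<in> X \<Longrightarrow> \<exists>b\<in>Range (h (nx \<tau> \<beta>)). \<beta> < b" by metis
  obtain t where t: "t \<in> D" "cohen_part \<rho> \<subseteq> t" using D(2) cohen_part_seqs[OF X_seqs[OF \<rho>]] by blast
  have ts: "t \<in> seqs" using t(1) D(1) by blast
  obtain m where m: "\<And>\<chi> b. \<chi> \<in> seqs \<Longrightarrow> b \<in> Range (h \<chi>) \<Longrightarrow> b < m \<chi>" "\<And>\<chi>. code \<chi> < m \<chi>"
    using ex_node_bound by blast
  \<comment> \<open>\<open>inv_into seqs code\<close> turns a closure condition on nodes into one on
    ordinals: if the code of a node and the bound are below a closure point, so are the code of the
    answer \<open>nx\<close> and the values of \<open>h\<close> there. The term
    \<open>code \<rho>\<close> gets the induction started.\<close>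
  obtain g where g: "\<And>\<gamma> \<xi> \<beta>. \<gamma> \<le> \<beta> \<Longrightarrow> \<xi> \<le> \<beta> \<Longrightarrow>
      max (code \<rho>) (m (nx (inv_into seqs code \<gamma>) \<xi>)) < g \<beta>"
    using bounding_function[of "\<lambda>\<gamma> \<xi>. max (code \<rho>) (m (nx (inv_into seqs code \<gamma>) \<xi>))"] by blast
  obtain \<alpha> a where \<alpha>: "dec \<alpha> = t" "closure_point g \<alpha>" "ladder a \<alpha>"
    using dec[OF ts] unfolding stat_def by blast
  have g_lt: "g \<beta> < \<alpha>" if "\<beta> < \<alpha>" for \<beta> using \<alpha>(2) that unfolding closure_point_def by blast
  have a_lt: "a n < \<alpha>" for n using \<alpha>(3) unfolding ladder_def by blast
  \<comment> \<open>The bounds \<open>a n\<close> drive the values of \<open>h\<close> up to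
    \<open>\<alpha>\<close>, while closure keeps them below \<open>\<alpha>\<close>.\<close>
  define s where "s = rec_nat \<rho> (\<lambda>n \<tau>. nx \<tau> (max (code \<tau>) (a n)))"
  have s0: "s 0 = \<rho>" and sS: "s (Suc n) = nx (s n) (max (code (s n)) (a n))" for n
    by (simp_all add: s_def)
  have sX: "s n \<in> X" for n by (induction n) (simp_all add: s0 sS \<rho> nx(1))
  have sn: "s n \<in> seqs" for n using X_seqs[OF sX] .
  have s_nxt: "s (Suc n) \<in> nxt (s n)" for n unfolding sS by (rule nx(2)[OF sX])
  have s_lt: "s n \<subset> s (Suc n)" for n using s_nxt[of n] unfolding nxt_def by blast
  have m_step: "m (s (Suc n)) < \<alpha>" if "code (s n) < \<alpha>" for n
  proof -
    let ?\<beta> = "max (code (s n)) (a n)"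
    have "m (s (Suc n)) < g ?\<beta>"
      using g[of "code (s n)" ?\<beta> ?\<beta>] code sn by (simp add: sS)
    also have "\<dots> < \<alpha>" using g_lt[of ?\<beta>] that a_lt by simp
    finally show ?thesis .
  qed
  have code_lt: "code (s n) < \<alpha>" for n
  proof (induction n)
    case 0
    have "code \<rho> < g (a 0)" using g[of "a 0" "a 0" "a 0"] by simp
    then show ?case using g_lt[OF a_lt[of 0]] by (simp add: s0)
  next
    case (Suc n)
    show ?case using m(2) m_step[OF Suc] by (rule less_trans)
  qed
  have m_lt: "m (s (Suc n)) < \<alpha>" for n by (rule m_step[OF code_lt])
  define L where "L = (\<Union>n. s n)"
  have s_mono: "s i \<subseteq> s j" if "i \<le> j" for i j by (rule nxt_chain_mono[of s, OF s_nxt that])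
  have sL: "s n \<subset> L" for n using s_lt[of n] unfolding L_def by blast
  have Ls: "L \<in> seqs"
  proof -
    obtain \<beta> where \<beta>: "\<And>n. len (s n) < \<beta>" using small_bound[OF small_nat, of "\<lambda>n. len (s n)"] by auto
    show ?thesis
      unfolding L_def
    proof (rule seqs_Union)
      show "range s \<subseteq> seqs" using sn by blast
      show "\<sigma> \<subseteq> \<tau> \<or> \<tau> \<subseteq> \<sigma>" if st: "\<sigma> \<in> range s" "\<tau> \<in> range s" for \<sigma> \<tau>
      proof -
        obtain i j where "\<sigma> = s i" "\<tau> = s j" using st by blast
        then show ?thesis using s_mono[of i j] s_mono[of j i] nat_le_linear[of i j] by blast
      qed
      show "len \<sigma> \<le> \<beta>" if "\<sigma> \<in> range s" for \<sigma> using that less_imp_le[OF \<beta>] by blast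
    qed
  qed
  have below: "\<exists>n. \<pi> \<subseteq> s n" if "\<pi> \<in> seqs" "\<pi> \<subset> L" for \<pi>
    by (rule below_chain_Union[of s, OF sn Ls[unfolded L_def] that(1) that(2)[unfolded L_def]]) blast
  have LR: "L \<in> R"
  proof (rule limit_closed_closure[OF P_tree[OF R(1)] P_limit_closed[OF R(1)] Ls])
    show "L \<noteq> {}" using sL[of 0] by blast
    fix \<iota> assume "\<iota> \<in> Domain L"
    then obtain n where n: "\<iota> \<in> Domain (s n)" unfolding L_def by blast
    have "{z \<in> L. fst z \<le> \<iota>} \<subseteq> s n"
    proof (rule single_valued_union_Domain_subset)
      show "single_valued ({z \<in> L. fst z \<le> \<iota>} \<union> s n)"
        by (rule single_valued_subset[OF _ seqs_single_valued[OF Ls]]) (use sL[of n] in auto)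
      show "Domain {z \<in> L. fst z \<le> \<iota>} \<subseteq> Domain (s n)" using seqs_down[OF sn n] by auto
    qed
    moreover have "s n \<in> R" using sX unfolding X_def by blast
    ultimately show "\<exists>\<tau>\<in>R. {z \<in> L. fst z \<le> \<iota>} \<subseteq> \<tau>" by blast
  qed
  have s_mil: "milestone (s n)" for n using sX unfolding X_def by blast
  have "milestone L" unfolding L_def by (rule milestone_Union[OF s_mil s_lt Ls[unfolded L_def]])
  have L_lim: "limit_milestone L"
    unfolding limit_milestone_def
  proof (intro conjI allI impI)
    fix \<pi> assume "milestone \<pi> \<and> \<pi> \<subset> L"
    then obtain n where "\<pi> \<subseteq> s n" using below milestone_seqs by blast
    then have "\<pi> \<subset> s (Suc n)" using s_lt[of n] by blast
    then show "\<exists>\<chi>. milestone \<chi> \<and> \<pi> \<subset> \<chi> \<and> \<chi> \<subset> L"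
      using s_mil[of "Suc n"] sL[of "Suc n"] by blast
  qed fact
  have "value_sup L = \<alpha>"
    unfolding value_sup_def
  proof (rule Least_equality)
    show "\<forall>\<pi>\<in>seqs. \<pi> \<subset> L \<longrightarrow> (\<forall>b\<in>Range (h \<pi>). b \<le> \<alpha>)"
    proof (intro ballI impI)
      fix \<pi> b assume \<pi>: "\<pi> \<in> seqs" "\<pi> \<subset> L" "b \<in> Range (h \<pi>)"
      then obtain n where "\<pi> \<subseteq> s n" using below by blast
      then have "\<pi> \<subseteq> s (Suc n)" using s_lt[of n] by blast
      then have "b \<in> Range (h (s (Suc n)))" using h_mono[OF \<pi>(1) sn] \<pi>(3) by blast
      then have "b < m (s (Suc n))" by (rule m(1)[OF sn])
      also note m_lt
      finally show "b \<le> \<alpha>" by simp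
    qed
    fix \<beta> assume \<beta>: "\<forall>\<pi>\<in>seqs. \<pi> \<subset> L \<longrightarrow> (\<forall>b\<in>Range (h \<pi>). b \<le> \<beta>)"
    show "\<alpha> \<le> \<beta>"
    proof (rule ccontr)
      assume "\<not> \<alpha> \<le> \<beta>"
      then obtain n where n: "\<beta> < a n" using \<alpha>(3) unfolding ladder_def not_le by blast
      obtain b where b: "b \<in> Range (h (s (Suc n)))" "max (code (s n)) (a n) < b"
        using nx(3)[OF sX[of n], of "max (code (s n)) (a n)"] unfolding sS by blast
      have "b \<le> \<beta>" using \<beta> sn[of "Suc n"] sL[of "Suc n"] b(1) by blast
      moreover have "a n < b" using b(2) by simp
      then have "\<beta> < b" by (rule less_trans[OF n])
      ultimately show False by simp
    qed
  qed
  \<comment> \<open>Such a \<open>\<pi>\<close> would lie above some \<open>s k\<close> and within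
    \<open>s (Suc k)\<close>. Being a limit, it would leave a further milestone strictly between
    these two.\<close>
  have no_lim: "\<not> limit_milestone \<pi>" if \<pi>: "\<rho> \<subset> \<pi>" "\<pi> \<subset> L" for \<pi>
  proof
    assume lim: "limit_milestone \<pi>"
    then have mil: "milestone \<pi>" unfolding limit_milestone_def by blast
    have ps: "\<pi> \<in> seqs" using mil by (rule milestone_seqs)
    have ex: "\<exists>n. \<pi> \<subseteq> s n" using below ps \<pi>(2) .
    define n where "n = (LEAST n. \<pi> \<subseteq> s n)"
    have n: "\<pi> \<subseteq> s n" unfolding n_def using ex by (rule LeastI_ex)
    have "n \<noteq> 0" using n \<pi>(1) s0 by (metis psubsetE subset_antisym)
    then obtain k where k: "n = Suc k" using not0_implies_Suc by blast
    have "\<not> \<pi> \<subseteq> s k" using not_less_Least[of k "\<lambda>n. \<pi> \<subseteq> s n"] k unfolding n_def[symmetric] by simp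
    moreover have "\<pi> \<subseteq> s k \<or> s k \<subseteq> \<pi>"
      by (rule seqs_below_comparable[OF ps sn Ls]) (use \<pi>(2) sL in auto)
    ultimately have "s k \<subset> \<pi>" by blast
    then obtain \<chi> where \<chi>: "milestone \<chi>" "s k \<subset> \<chi>" "\<chi> \<subset> \<pi>"
      using lim s_mil[of k] unfolding limit_milestone_def by blast
    then have "\<chi> \<subset> s (Suc k)" using n k by blast
    then show False using no_milestone_between[OF s_mil[of k] \<chi>(1) s_nxt[of k] \<chi>(2)] by blast
  qed
  \<comment> \<open>Away from limit milestones the Cohen part is the union of the earlier ones, so
    nothing is added between \<open>\<rho>\<close> and \<open>L\<close>. Hence all parts read before
    \<open>L\<close> are contained in \<open>t\<close>, and the guard of \<open>read\<close> holds
    at \<open>L\<close>.\<close>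
  have const: "cohen_part \<pi> \<subseteq> cohen_part \<rho>" if "\<pi> \<in> seqs" "\<pi> \<subset> L" for \<pi>
    using wf_seqs_psubset that
  proof (induction \<pi> rule: wf_induct_rule)
    case (less \<pi>)
    have rs: "\<rho> \<in> seqs" by (rule X_seqs[OF \<rho>])
    have "\<pi> \<subseteq> \<rho> \<or> \<rho> \<subseteq> \<pi>"
      by (rule seqs_below_comparable[OF less.prems(1) rs Ls]) (use less.prems sL[of 0] s0 in auto)
    then consider "\<pi> \<subseteq> \<rho>" | "\<rho> \<subset> \<pi>" by blast
    then show ?case
    proof cases
      case 1
      then show ?thesis using cohen_part_mono[OF less.prems(1) rs] by blast
    next
      case 2
      have "cohen_part \<pi> = \<Union>(cohen_part ` {\<chi> \<in> seqs. \<chi> \<subset> \<pi>})"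
        unfolding cohen_part_eq[OF less.prems(1)] read_def Let_def
        using no_lim[OF 2 less.prems(2)] by simp
      also have "\<dots> \<subseteq> cohen_part \<rho>"
        using less.IH less.prems by (intro UN_least) auto
      finally show ?thesis .
    qed
  qed
  have "\<Union>(cohen_part ` {\<pi> \<in> seqs. \<pi> \<subset> L}) \<subseteq> t" using const t(2) by blast
  then have "cohen_part L = t"
    unfolding cohen_part_eq[OF Ls] read_def Let_def \<open>value_sup L = \<alpha>\<close> \<alpha>(1) using L_lim ts by simp
  then show ?thesis using LR t(1) by blast
qed

end

section \<open>The forcing relation\<close>

lemma forces_fNot: "forces P p (fNot \<phi>) \<longleftrightarrow> (\<forall>q\<in>P. q \<le> p \<longrightarrow> \<not> forces P q \<phi>)"
  by (simp add: forces_def fNot_def)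

lemma forces_fAnd: "forces P p (fAnd \<phi> \<psi>) \<longleftrightarrow> forces P p \<phi> \<and> forces P p \<psi>"
  by (simp add: forces_def fAnd_def)

lemma forces_fBall: "forces P p (fBall A \<phi>) \<longleftrightarrow> (\<forall>x\<in>A. forces P p (\<phi> x))"
  by (simp add: forces_def fBall_def)

lemma forces_fGround: "forces P p (fGround b) \<longleftrightarrow> b"
  by (simp add: forces_def fGround_def)

lemma forces_fBex:
  "forces P p (fBex A \<phi>) \<longleftrightarrow> (\<forall>q\<in>P. q \<le> p \<longrightarrow> (\<exists>x\<in>A. \<exists>r\<in>P. r \<le> q \<and> forces P r (\<phi> x)))"
  by (auto simp: fBex_def forces_fNot forces_fBall)

lemma forces_fImp:
  "forces P p (fImp \<phi> \<psi>) \<longleftrightarrow>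
     (\<forall>q\<in>P. q \<le> p \<longrightarrow> forces P q \<phi> \<longrightarrow> (\<exists>r\<in>P. r \<le> q \<and> forces P r \<psi>))"
  by (auto simp: fImp_def forces_fNot forces_fAnd)

lemma forces_fMem:
  "forces P p (fMem a \<tau>) \<longleftrightarrow>
     (\<forall>q\<in>P. q \<le> p \<longrightarrow> (\<exists>r\<in>P. r \<le> q \<and> (\<exists>s\<in>P. (a, s) \<in> \<tau> \<and> r \<le> s)))"
  by (simp add: forces_def fMem_def)

lemma forces_fSubset: "forces P p (fSubset A \<tau>) \<longleftrightarrow> (\<forall>a\<in>A. forces P p (fMem a \<tau>))"
  by (simp add: fSubset_def forces_fBall)

lemmas forces_iffs = forces_fNot forces_fAnd forces_fBall forces_fGround forces_fBex forces_fImp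
  forces_fSubset

lemma forces_fMem_mono: "forces P p (fMem a \<tau>) \<Longrightarrow> q \<le> p \<Longrightarrow> forces P q (fMem a \<tau>)"
  unfolding forces_fMem by (auto dest: order.trans)

lemma forces_fSubset_mono: "forces P p (fSubset A \<tau>) \<Longrightarrow> q \<le> p \<Longrightarrow> forces P q (fSubset A \<tau>)"
  unfolding forces_fSubset by (auto intro: forces_fMem_mono)

section \<open>Deciding pieces of the generic real and of its image\<close>

lemma lim_name_decides:
  assumes "p \<in> P" "forces P p (fMem z (lim_name P h \<tau>))"
  obtains q \<sigma> where "q \<in> P" "q \<le> p" "\<sigma> \<in> seqs" "forces P q (fSubset \<sigma> \<tau>)" "z \<in> h \<sigma>"
proof -
  obtain r s where rs: "r \<in> P" "r \<le> p" "(z, s) \<in> lim_name P h \<tau>" "r \<le> s"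
    using assms unfolding forces_fMem by blast
  have "forces P s (fBex seqs (\<lambda>\<sigma>. fAnd (fSubset \<sigma> \<tau>) (fGround (z \<in> h \<sigma>))))"
    using rs(3) unfolding lim_name_def name_Collect_def by simp
  then obtain \<sigma> q where q: "\<sigma> \<in> seqs" "q \<in> P" "q \<le> r" "forces P q (fSubset \<sigma> \<tau>)" "z \<in> h \<sigma>"
    using rs(1,4) unfolding forces_fBex forces_fAnd forces_fGround by blast
  have "q \<le> p" using q(3) rs(2) by (rule order.trans)
  then show ?thesis using that q by blast
qed

text \<open>Every \<open>r\<close> forces itself into the generic filter, and \<open>q\<close>
  forces \<open>\<tau>\<close> into all conditions of that filter. So \<open>\<tau>\<close> lies in
  each \<open>r\<close> below \<open>q\<close>.\<close>

lemma x_gen_decides: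
  assumes "R \<in> P" "forces P R (fMem z (x_gen P))"
  obtains q \<tau> where "q \<in> P" "q \<subseteq> R" "z \<in> \<tau>" "\<And>r. r \<in> P \<Longrightarrow> r \<subseteq> q \<Longrightarrow> \<tau> \<in> r"
proof -
  let ?\<phi> = "\<lambda>\<sigma>. fAnd (fGround (z \<in> \<sigma>))
       (fBall P (\<lambda>S. fImp (fMem S (filter_name P)) (fGround (\<sigma> \<in> S))))"
  obtain r s where rs: "r \<in> P" "r \<subseteq> R" "s \<in> P" "(z, s) \<in> x_gen P" "r \<subseteq> s"
    using assms unfolding forces_fMem by blast
  have "forces P s (fBex seqs ?\<phi>)" using rs(4) unfolding x_gen_def name_Collect_def by simp
  then obtain \<tau> q where q: "q \<in> P" "q \<subseteq> r" "forces P q (?\<phi> \<tau>)"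
    using rs(1,5) unfolding forces_fBex by blast
  show ?thesis
  proof (rule that[OF q(1)])
    show "q \<subseteq> R" using q(2) rs(2) by (rule subset_trans)
    show "z \<in> \<tau>" using q(3) by (simp add: forces_iffs)
    fix r' assume r': "r' \<in> P" "r' \<subseteq> q"
    have "forces P r' (fMem r' (filter_name P))"
      unfolding forces_fMem filter_name_def using r'(1) by auto
    moreover have "forces P q (fImp (fMem r' (filter_name P)) (fGround (\<tau> \<in> r')))"
      using q(3) r'(1) by (simp add: forces_fAnd forces_fBall)
    ultimately show "\<tau> \<in> r'" using r' unfolding forces_fImp forces_fGround by blast
  qed
qed

context regular_uncountable
begin

text \<open>Distributivity decides the fewer than \<open>\<kappa>\<close> elements of \<open>\<sigma>\<close> simultaneously.\<close>

lemma x_gen_node: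
  fixes P :: "('k \<times> 'k) set set set"
  assumes P: "tree_forcing P" "lt_distributive \<kappa> (\<subseteq>) P"
    and R: "R \<in> P" "forces P R (fSubset \<sigma> (x_gen P))" and \<sigma>: "\<sigma> \<in> seqs" "\<sigma> \<noteq> {}"
  obtains q where "q \<in> P" "q \<subseteq> R" "\<sigma> \<in> q"
proof -
  define E where "E z = {q \<in> P. \<exists>\<tau>. z \<in> \<tau> \<and> (\<forall>r\<in>P. r \<subseteq> q \<longrightarrow> \<tau> \<in> r)}" for z
  \<comment> \<open>The conditions incompatible with \<open>R\<close> are added to make the set
    dense in all of \<open>P\<close>, as distributivity requires; a condition below \<open>R\<close>
    is not among them.\<close>
  define D where "D z = E z \<union> {q \<in> P. \<forall>r\<in>P. r \<subseteq> q \<longrightarrow> \<not> r \<subseteq> R}" for z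
  have D: "open_dense_in (\<subseteq>) P (D z)" if "z \<in> \<sigma>" for z
    unfolding open_dense_in_def dense_in_def
  proof (intro conjI ballI impI)
    show "D z \<subseteq> P" unfolding D_def E_def by blast
    fix p assume p: "p \<in> P"
    show "\<exists>q\<in>D z. q \<subseteq> p"
    proof (cases "\<exists>r\<in>P. r \<subseteq> p \<and> r \<subseteq> R")
      case True
      then obtain r where r: "r \<in> P" "r \<subseteq> p" "r \<subseteq> R" by blast
      have "forces P r (fMem z (x_gen P))"
        using forces_fSubset_mono[OF R(2) r(3)] that unfolding forces_fSubset by blast
      then obtain q \<tau> where "q \<in> P" "q \<subseteq> r" "z \<in> \<tau>" "\<And>r. r \<in> P \<Longrightarrow> r \<subseteq> q \<Longrightarrow> \<tau> \<in> r"
        by (rule x_gen_decides[OF r(1)]) blast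
      then have "q \<in> E z" unfolding E_def by blast
      then show ?thesis using \<open>q \<subseteq> r\<close> r(2) unfolding D_def by blast
    next
      case False
      then show ?thesis using p unfolding D_def by blast
    qed
  next
    fix p q assume pq: "p \<in> D z" "q \<in> P" "q \<subseteq> p"
    have sub: "r \<subseteq> p" if "r \<subseteq> q" for r using that pq(3) by (rule subset_trans)
    from pq(1) consider \<tau> where "z \<in> \<tau>" "\<And>r. r \<in> P \<Longrightarrow> r \<subseteq> p \<Longrightarrow> \<tau> \<in> r"
      | "\<And>r. r \<in> P \<Longrightarrow> r \<subseteq> p \<Longrightarrow> \<not> r \<subseteq> R"
      unfolding D_def E_def by auto
    then show "q \<in> D z"
    proof cases
      case 1
      then have "q \<in> E z" unfolding E_def using pq(2) sub by (simp, intro exI[of _ \<tau>]) simp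
      then show ?thesis unfolding D_def by simp
    next
      case 2
      then show ?thesis unfolding D_def using pq(2) sub by simp
    qed
  qed
  have "|D ` \<sigma>| <o \<kappa>" by (rule small_image[OF small_seq[OF \<sigma>(1)]])
  moreover have "\<forall>X\<in>D ` \<sigma>. open_dense_in (\<subseteq>) P X" using D by simp
  ultimately have "open_dense_in (\<subseteq>) P (P \<inter> \<Inter>(D ` \<sigma>))"
    by (intro P(2)[unfolded lt_distributive_def, THEN spec, THEN mp] conjI)
  then have "\<exists>q\<in>P \<inter> \<Inter>(D ` \<sigma>). q \<subseteq> R"
    using R(1) unfolding open_dense_in_def dense_in_def by simp
  then obtain q where q: "q \<in> P" "q \<subseteq> R" "\<And>z. z \<in> \<sigma> \<Longrightarrow> q \<in> D z" by auto
  have tree: "is_tree q" "limit_closed q" "\<And>\<chi>. \<chi> \<in> q \<Longrightarrow> tree_restrict q \<chi> \<in> P"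
    using P(1) q(1) unfolding tree_forcing_def by auto
  have "q \<in> E z" if "z \<in> \<sigma>" for z using q(1,2) q(3)[OF that] unfolding D_def by blast
  then have "\<forall>z\<in>\<sigma>. \<exists>\<tau>. z \<in> \<tau> \<and> (\<forall>r\<in>P. r \<subseteq> q \<longrightarrow> \<tau> \<in> r)"
    unfolding E_def by simp
  then obtain \<tau> where "\<forall>z\<in>\<sigma>. z \<in> \<tau> z \<and> (\<forall>r\<in>P. r \<subseteq> q \<longrightarrow> \<tau> z \<in> r)"
    by (rule bchoice[THEN exE])
  then have \<tau>: "z \<in> \<tau> z" "r \<in> P \<Longrightarrow> r \<subseteq> q \<Longrightarrow> \<tau> z \<in> r" if "z \<in> \<sigma>" for z r
    using that by simp_all
  have \<tau>q: "\<tau> z \<in> q" if "z \<in> \<sigma>" for z using \<tau>(2)[OF that q(1)] by blast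
  \<comment> \<open>Restricting \<open>q\<close> to \<open>\<chi>\<close> gives a condition that
    still contains \<open>\<tau> z\<close>. Thus \<open>\<tau> z\<close> belongs to the stem of
    \<open>q\<close>.\<close>
  have cmp: "\<tau> z \<subseteq> \<chi> \<or> \<chi> \<subseteq> \<tau> z" if "z \<in> \<sigma>" "\<chi> \<in> q" for z \<chi>
  proof -
    have "tree_restrict q \<chi> \<subseteq> q" unfolding tree_restrict_def by blast
    then have "\<tau> z \<in> tree_restrict q \<chi>" by (rule \<tau>(2)[OF that(1) tree(3)[OF that(2)]])
    then show ?thesis unfolding tree_restrict_def by blast
  qed
  have seq: "\<chi> \<in> seqs" if "\<chi> \<in> q" for \<chi> using that tree(1) unfolding is_tree_def by blast
  \<comment> \<open>The stem nodes \<open>\<tau> z\<close> cohere, so the one chosen for the pair at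
    \<open>\<iota>\<close> contains all of \<open>\<sigma>\<close> up to
    \<open>\<iota>\<close>.\<close>
  have "\<sigma> \<in> q"
  proof (rule limit_closed_closure[OF tree(1,2) \<sigma>])
    fix \<iota> assume "\<iota> \<in> Domain \<sigma>"
    then obtain b where z: "(\<iota>, b) \<in> \<sigma>" by blast
    let ?\<tau> = "\<tau> (\<iota>, b)"
    have "{z \<in> \<sigma>. fst z \<le> \<iota>} \<subseteq> ?\<tau>"
    proof
      fix y assume "y \<in> {z \<in> \<sigma>. fst z \<le> \<iota>}"
      then obtain a c where y: "y = (a, c)" "(a, c) \<in> \<sigma>" "a \<le> \<iota>" by (cases y) auto
      have "\<iota> \<in> Domain ?\<tau>" using \<tau>(1)[OF z] by blast
      then have "a \<in> Domain ?\<tau>" using seqs_down[OF seq[OF \<tau>q[OF z]]] y(3) by blast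
      then obtain c' where c': "(a, c') \<in> ?\<tau>" by blast
      have in_y: "(a, c) \<in> \<tau> (a, c)" by (rule \<tau>(1)[OF y(2)])
      have sv: "single_valued ?\<tau>" "single_valued (\<tau> (a, c))"
        using seqs_single_valued[OF seq[OF \<tau>q]] z y(2) by simp_all
      from cmp[OF z \<tau>q[OF y(2)]] have "c = c'"
      proof
        assume "?\<tau> \<subseteq> \<tau> (a, c)"
        then show ?thesis using c' in_y single_valuedD[OF sv(2)] by blast
      next
        assume "\<tau> (a, c) \<subseteq> ?\<tau>"
        then show ?thesis using c' in_y single_valuedD[OF sv(1)] by blast
      qed
      then show "y \<in> ?\<tau>" using c' y(1) by simp
    qed
    then show "\<exists>\<tau>\<in>q. {z \<in> \<sigma>. fst z \<le> \<iota>} \<subseteq> \<tau>" using \<tau>q[OF z] by blast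
  qed
  then show ?thesis using that q by blast
qed

text \<open>The empty sequence is a separate alternative because \<open>x_gen_node\<close> excludes
  it.\<close>

lemma lim_x_gen_decides:
  fixes P :: "('k \<times> 'k) set set set"
  assumes P: "tree_forcing P" "lt_distributive \<kappa> (\<subseteq>) P"
    and R: "R \<in> P" "forces P R (fMem z (lim_name P h (x_gen P)))"
  obtains q \<sigma> where "q \<in> P" "q \<subseteq> R" "\<sigma> = {} \<or> \<sigma> \<in> q" "z \<in> h \<sigma>"
proof -
  obtain p \<sigma> where p: "p \<in> P" "p \<subseteq> R" "\<sigma> \<in> seqs" "forces P p (fSubset \<sigma> (x_gen P))" "z \<in> h \<sigma>"
    by (rule lim_name_decides[OF R])
  show ?thesis
  proof (cases "\<sigma> = {}")
    case True
    then show ?thesis using that p by blast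
  next
    case False
    obtain q where "q \<in> P" "q \<subseteq> p" "\<sigma> \<in> q" by (rule x_gen_node[OF P p(1,4,3) False])
    then show ?thesis using that p by blast
  qed
qed

section \<open>From a dominating name to properties of trees\<close>

lemma unbounded_of_dominating:
  fixes P :: "('k \<times> 'k) set set set"
  assumes P: "tree_forcing P" "lt_distributive \<kappa> (\<subseteq>) P" and h: "pre_continuous h"
    and T: "forces P T (fDominating (lim_name P h (x_gen P)))"
    and R: "R \<in> P" "R \<subseteq> T"
  shows "\<exists>\<tau>\<in>R. \<alpha> \<in> Domain (h \<tau>)"
proof -
  \<comment> \<open>Taking the maximum ensures that the deciding sequence is not the empty
    one.\<close>
  let ?\<alpha> = "max \<alpha> (len (h {}))"
  have h_seqs: "h \<sigma> \<in> seqs" if "\<sigma> \<in> seqs" for \<sigma> using h that by (simp add: pre_continuous_def)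
  have "forces P T (fBex UNIV (\<lambda>\<beta>. fMem (?\<alpha>, \<beta>) (lim_name P h (x_gen P))))"
    using T unfolding fDominating_def fFunction_def forces_fAnd forces_fBall by blast
  then obtain r \<beta> where r: "r \<in> P" "r \<subseteq> R" "forces P r (fMem (?\<alpha>, \<beta>) (lim_name P h (x_gen P)))"
    using R unfolding forces_fBex by blast
  obtain q \<sigma> where q: "q \<in> P" "q \<subseteq> r" "\<sigma> = {} \<or> \<sigma> \<in> q" "(?\<alpha>, \<beta>) \<in> h \<sigma>"
    by (rule lim_x_gen_decides[OF P r(1,3)])
  have "\<sigma> \<noteq> {}"
  proof
    assume "\<sigma> = {}"
    then have "?\<alpha> \<in> Domain (h {})" using q(4) by blast
    then show False using seqs_Domain[OF h_seqs[OF seqs_empty]] by auto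
  qed
  then have "\<sigma> \<in> q" using q(3) by blast
  then have "\<sigma> \<in> seqs" using P(1) q(1) unfolding tree_forcing_def is_tree_def by blast
  then have "\<alpha> \<in> Domain (h \<sigma>)"
    using seqs_down[OF h_seqs, of \<sigma> ?\<alpha> \<alpha>] q(4) by auto
  then show ?thesis using \<open>\<sigma> \<in> q\<close> q(2) r(2) by blast
qed

text \<open>Below the restriction of \<open>R'\<close> to \<open>\<tau>\<close>, some condition
  decides a value \<open>\<beta>' \<ge> g \<alpha>\<close> through a sequence comparable with
  \<open>\<tau>\<close>. Monotonicity of \<open>h\<close> identifies \<open>\<beta>'\<close> with
  the value given by \<open>h \<tau>\<close>.\<close>

lemma dominates_of_dominating:
  fixes P :: "('k \<times> 'k) set set set"
  assumes P: "tree_forcing P" "lt_distributive \<kappa> (\<subseteq>) P" and h: "pre_continuous h"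
    and T: "forces P T (fDominating (lim_name P h (x_gen P)))"
    and R: "R \<in> P" "R \<subseteq> T"
  shows "\<exists>R'\<in>P. R' \<subseteq> R \<and> (\<exists>\<alpha>\<^sub>0. \<forall>\<tau>\<in>R'. \<forall>\<alpha> \<beta>. (\<alpha>, \<beta>) \<in> h \<tau> \<longrightarrow> \<alpha>\<^sub>0 < \<alpha> \<longrightarrow> g \<alpha> \<le> \<beta>)"
proof -
  let ?d = "lim_name P h (x_gen P)"
  have h_seqs: "h \<sigma> \<in> seqs" if "\<sigma> \<in> seqs" for \<sigma> using h that by (simp add: pre_continuous_def)
  have h_mono: "h \<sigma> \<subseteq> h \<tau>" if "\<sigma> \<in> seqs" "\<tau> \<in> seqs" "\<sigma> \<subseteq> \<tau>" for \<sigma> \<tau>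
    using h that by (simp add: pre_continuous_def)
  have "forces P T (fBex UNIV (\<lambda>\<alpha>\<^sub>0. fBall {\<alpha>\<^sub>0<..} (\<lambda>\<alpha>. fBex {g \<alpha>..} (\<lambda>\<beta>. fMem (\<alpha>, \<beta>) ?d))))"
    using T unfolding fDominating_def forces_fAnd forces_fBall by blast
  then obtain R' \<alpha>\<^sub>0 where R': "R' \<in> P" "R' \<subseteq> R"
    and "forces P R' (fBall {\<alpha>\<^sub>0<..} (\<lambda>\<alpha>. fBex {g \<alpha>..} (\<lambda>\<beta>. fMem (\<alpha>, \<beta>) ?d)))"
    using R unfolding forces_fBex[of P T] by blast
  then have d: "forces P R' (fBex {g \<alpha>..} (\<lambda>\<beta>. fMem (\<alpha>, \<beta>) ?d))" if "\<alpha>\<^sub>0 < \<alpha>" for \<alpha>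
    using that by (simp add: forces_fBall)
  have "g \<alpha> \<le> \<beta>" if \<tau>: "\<tau> \<in> R'" "(\<alpha>, \<beta>) \<in> h \<tau>" and \<alpha>: "\<alpha>\<^sub>0 < \<alpha>" for \<tau> \<alpha> \<beta>
  proof -
    let ?S = "tree_restrict R' \<tau>"
    have seqs: "\<sigma> \<in> seqs" if "q \<in> P" "\<sigma> \<in> q" for q \<sigma>
      using P(1) that unfolding tree_forcing_def is_tree_def by blast
    have S: "?S \<in> P" using P(1) R'(1) \<tau>(1) unfolding tree_forcing_def by blast
    have S': "?S \<subseteq> R'" unfolding tree_restrict_def by blast
    obtain r \<beta>' where r: "r \<in> P" "r \<subseteq> ?S" "g \<alpha> \<le> \<beta>'" "forces P r (fMem (\<alpha>, \<beta>') ?d)"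
      using d[OF \<alpha>] S S' unfolding forces_fBex by fastforce
    obtain q \<sigma> where q: "q \<in> P" "q \<subseteq> r" "\<sigma> = {} \<or> \<sigma> \<in> q" "(\<alpha>, \<beta>') \<in> h \<sigma>"
      by (rule lim_x_gen_decides[OF P r(1,4)])
    have \<tau>s: "\<tau> \<in> seqs" using seqs R'(1) \<tau>(1) by blast
    have \<sigma>s: "\<sigma> \<in> seqs" using q(3) seqs[OF q(1)] by auto
    have "\<sigma> \<subseteq> \<tau> \<or> \<tau> \<subseteq> \<sigma>" using q(2,3) r(2) unfolding tree_restrict_def by blast
    then have "h \<sigma> \<subseteq> h \<tau> \<or> h \<tau> \<subseteq> h \<sigma>" using h_mono \<sigma>s \<tau>s by blast
    then have "\<beta> = \<beta>'"
      using q(4) \<tau>(2) single_valuedD[OF seqs_single_valued[OF h_seqs[OF \<sigma>s]]]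
        single_valuedD[OF seqs_single_valued[OF h_seqs[OF \<tau>s]]] by blast
    then show ?thesis using r(3) by simp
  qed
  then show ?thesis using R' by blast
qed

end

section \<open>The Cohen real\<close>

context dominated_tree_forcing
begin

text \<open>The union of the Cohen parts along the generic real: a node of \<open>S\<close>
  comparable with all nodes of \<open>S\<close> is a stem node, which \<open>S\<close> forces to be
  an initial segment of that real.\<close>

definition cohen_name :: "('k \<times> bool, ('k \<times> 'k) set set) name" where
  "cohen_name = {(z, S). \<exists>\<sigma>\<in>S. z \<in> cohen_part \<sigma> \<and> (\<forall>\<tau>\<in>S. \<sigma> \<subseteq> \<tau> \<or> \<tau> \<subseteq> \<sigma>)}"

lemma forces_cohen_part:
  assumes "R \<in> P" "\<sigma> \<in> R"
  shows "forces P (tree_restrict R \<sigma>) (fSubset (cohen_part \<sigma>) cohen_name)"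
  unfolding forces_fSubset forces_fMem
proof (intro ballI impI)
  fix z q assume "z \<in> cohen_part \<sigma>" "q \<in> P" "q \<subseteq> tree_restrict R \<sigma>"
  moreover have "(z, tree_restrict R \<sigma>) \<in> cohen_name"
    unfolding cohen_name_def tree_restrict_def using calculation assms by auto
  moreover have "tree_restrict R \<sigma> \<in> P" using P_restrict[OF assms] .
  ultimately show "\<exists>r\<in>P. r \<subseteq> q \<and> (\<exists>s\<in>P. (z, s) \<in> cohen_name \<and> r \<subseteq> s)" by blast
qed

text \<open>A stem node \<open>\<sigma>\<close> of \<open>s\<close> stays in every condition
  \<open>r\<close> below \<open>s\<close> and \<open>R\<close>: by \<open>unbounded\<close>, some
  node of \<open>r\<close> decides more than \<open>\<sigma>\<close> does and therefore extends
  it.\<close>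

lemma cohen_name_decides:
  assumes R: "R \<in> P" "R \<subseteq> T" "forces P R (fMem z cohen_name)"
  obtains r \<sigma> where "r \<in> P" "r \<subseteq> R" "\<sigma> \<in> r" "z \<in> cohen_part \<sigma>" "\<forall>\<tau>\<in>r. \<sigma> \<subseteq> \<tau> \<or> \<tau> \<subseteq> \<sigma>"
proof -
  obtain r s where rs: "r \<in> P" "r \<subseteq> R" "s \<in> P" "(z, s) \<in> cohen_name" "r \<subseteq> s"
    using R unfolding forces_fMem by blast
  obtain \<sigma> where \<sigma>: "\<sigma> \<in> s" "z \<in> cohen_part \<sigma>" "\<And>\<tau>. \<tau> \<in> s \<Longrightarrow> \<sigma> \<subseteq> \<tau> \<or> \<tau> \<subseteq> \<sigma>"
    using rs(4) unfolding cohen_name_def by blast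
  have \<sigma>s: "\<sigma> \<in> seqs" using P_seqs[OF rs(3) \<sigma>(1)] .
  have rT: "r \<subseteq> T" using rs(2) R(2) by blast
  obtain \<tau> where \<tau>: "\<tau> \<in> r" "len (h \<sigma>) \<in> Domain (h \<tau>)" using unbounded[OF rs(1) rT] by blast
  have "\<not> \<tau> \<subseteq> \<sigma>"
    using Domain_h_mono[OF P_seqs[OF rs(1) \<tau>(1)] \<sigma>s _ \<tau>(2)] seqs_Domain[OF h_seqs[OF \<sigma>s]] by auto
  then have "\<sigma> \<subseteq> \<tau>" using \<sigma>(3) \<tau>(1) rs(5) by blast
  then have "\<sigma> \<in> r" by (rule P_down[OF rs(1) \<tau>(1) \<sigma>s])
  then show ?thesis using that[OF rs(1,2) _ \<sigma>(2)] \<sigma>(3) rs(5) by blast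
qed

text \<open>Deciding the second value below the condition that decides the first gives two
  comparable nodes, whose Cohen parts are then nested.\<close>

lemma cohen_name_single_valued:
  assumes R: "R \<in> P" "R \<subseteq> T"
    and m: "forces P R (fMem (\<alpha>, b) cohen_name)" "forces P R (fMem (\<alpha>, b') cohen_name)"
  shows "b = b'"
proof -
  obtain r \<sigma> where r: "r \<in> P" "r \<subseteq> R" "\<sigma> \<in> r" "(\<alpha>, b) \<in> cohen_part \<sigma>"
    "\<forall>\<tau>\<in>r. \<sigma> \<subseteq> \<tau> \<or> \<tau> \<subseteq> \<sigma>"
    by (rule cohen_name_decides[OF R m(1)])
  have rT: "r \<subseteq> T" using r(2) R(2) by blast
  obtain r' \<sigma>' where r': "r' \<in> P" "r' \<subseteq> r" "\<sigma>' \<in> r'" "(\<alpha>, b') \<in> cohen_part \<sigma>'"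
    "\<forall>\<tau>\<in>r'. \<sigma>' \<subseteq> \<tau> \<or> \<tau> \<subseteq> \<sigma>'"
    by (rule cohen_name_decides[OF r(1) rT forces_fMem_mono[OF m(2) r(2)]])
  have s: "\<sigma> \<in> seqs" "\<sigma>' \<in> seqs" using P_seqs r(1,3) r'(1,3) by blast+
  have "\<sigma> \<subseteq> \<sigma>' \<or> \<sigma>' \<subseteq> \<sigma>" using r(5) r'(2,3) by blast
  then have "cohen_part \<sigma> \<subseteq> cohen_part \<sigma>' \<or> cohen_part \<sigma>' \<subseteq> cohen_part \<sigma>"
    using cohen_part_mono s by blast
  then show ?thesis
    using r(4) r'(4) single_valuedD[OF seqs_single_valued[OF cohen_part_seqs[OF s(1)]]]
      single_valuedD[OF seqs_single_valued[OF cohen_part_seqs[OF s(2)]]] by blast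
qed

lemma ex_long_seq:
  fixes t :: "('k \<times> bool) set"
  assumes t: "t \<in> seqs" obtains t' where "t' \<in> seqs" "t \<subseteq> t'" "\<alpha> \<in> Domain t'"
proof -
  obtain \<beta> where \<beta>: "max \<alpha> (len t) < \<beta>" using ex_greater by blast
  define t' where "t' = t \<union> {(\<xi>, True) | \<xi>. len t \<le> \<xi> \<and> \<xi> < \<beta>}"
  have "Domain t' = {..<\<beta>}"
    unfolding t'_def Domain_Un_eq seqs_Domain[OF t] using \<beta> by (auto simp: not_less)
  moreover have "single_valued t'"
  proof -
    have "\<xi> < len t" if "(\<xi>, b) \<in> t" for \<xi> b using seqs_Domain_iff[OF t] that by blast
    then show ?thesis
      using single_valuedD[OF seqs_single_valued[OF t]] unfolding t'_def single_valued_def by (auto simp: not_le[symmetric])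
  qed
  ultimately have "t' \<in> seqs" "\<alpha> \<in> Domain t'" using \<beta> unfolding seqs_def by auto
  then show ?thesis using that unfolding t'_def by blast
qed

lemma forces_cohen_name_meets:
  assumes "D \<subseteq> seqs" "\<And>t. t \<in> seqs \<Longrightarrow> \<exists>t'\<in>D. t \<subseteq> t'"
  shows "forces P T (fBex D (\<lambda>\<sigma>. fSubset \<sigma> cohen_name))"
  unfolding forces_fBex
proof (intro ballI impI)
  fix q assume q: "q \<in> P" "q \<subseteq> T"
  obtain \<sigma> where \<sigma>: "\<sigma> \<in> q" "cohen_part \<sigma> \<in> D" using cohen_part_hits[OF q assms] by blast
  have "tree_restrict q \<sigma> \<subseteq> q" unfolding tree_restrict_def by blast
  then show "\<exists>t\<in>D. \<exists>r\<in>P. r \<subseteq> q \<and> forces P r (fSubset t cohen_name)"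
    using forces_cohen_part[OF q(1) \<sigma>(1)] P_restrict[OF q(1) \<sigma>(1)] \<sigma>(2) by blast
qed

lemma forces_cohen_name_function: "forces P T (fFunction cohen_name)"
  unfolding fFunction_def forces_fAnd
proof
  show "forces P T (fBall UNIV (\<lambda>\<alpha>. fBex UNIV (\<lambda>b. fMem (\<alpha>, b) cohen_name)))"
    unfolding forces_fBall
  proof
    fix \<alpha> :: 'k
    \<comment> \<open>Totality is an instance of genericity: the sequences defined at
      \<open>\<alpha>\<close> are dense.\<close>
    have meets: "forces P T (fBex {t \<in> seqs. \<alpha> \<in> Domain t} (\<lambda>\<sigma>. fSubset \<sigma> cohen_name))"
    proof (rule forces_cohen_name_meets)
      fix t :: "('k \<times> bool) set" assume "t \<in> seqs"
      then obtain t' where "t' \<in> seqs" "t \<subseteq> t'" "\<alpha> \<in> Domain t'" by (rule ex_long_seq)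
      then show "\<exists>t'\<in>{t \<in> seqs. \<alpha> \<in> Domain t}. t \<subseteq> t'" by blast
    qed blast
    show "forces P T (fBex UNIV (\<lambda>b. fMem (\<alpha>, b) cohen_name))"
      unfolding forces_fBex
    proof (intro ballI impI)
      fix q assume q: "q \<in> P" "q \<subseteq> T"
      obtain t r where t: "t \<in> {t \<in> seqs. \<alpha> \<in> Domain t}" and r: "r \<in> P" "r \<subseteq> q"
        and f: "forces P r (fSubset t cohen_name)"
        using meets[unfolded forces_fBex, THEN bspec, OF q(1), THEN mp, OF q(2)] by (elim bexE conjE)
      obtain b where "(\<alpha>, b) \<in> t" using t by blast
      then have "forces P r (fMem (\<alpha>, b) cohen_name)" using f by (simp add: forces_fSubset)
      then show "\<exists>b\<in>UNIV. \<exists>r\<in>P. r \<subseteq> q \<and> forces P r (fMem (\<alpha>, b) cohen_name)"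
        using r by (intro bexI[of _ b] bexI[of _ r]) simp_all
    qed
  qed
  show "forces P T (fBall UNIV (\<lambda>\<alpha>. fBall UNIV (\<lambda>b. fBall UNIV (\<lambda>b'.
      fImp (fAnd (fMem (\<alpha>, b) cohen_name) (fMem (\<alpha>, b') cohen_name)) (fGround (b = b'))))))"
    unfolding forces_fBall forces_fImp forces_fAnd forces_fGround
  proof (intro ballI impI)
    fix \<alpha> b b' q assume q: "q \<in> P" "q \<subseteq> T"
      and m: "forces P q (fMem (\<alpha>, b) cohen_name) \<and> forces P q (fMem (\<alpha>, b') cohen_name)"
    have "b = b'" using m by (intro cohen_name_single_valued[OF q, of \<alpha>]) simp_all
    then show "\<exists>r\<in>P. r \<subseteq> q \<and> b = b'" using q by blast
  qed
qed

lemma forces_cohen_name_generic: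
  "forces P T (fGenericFilter (\<supseteq>) seqs (\<lambda>\<sigma>. fSubset \<sigma> cohen_name))"
  unfolding fGenericFilter_def forces_fAnd forces_fBall
proof (intro conjI ballI)
  fix \<sigma> \<tau> :: "('k \<times> bool) set" assume "\<tau> \<in> {\<tau> \<in> seqs. \<tau> \<subseteq> \<sigma>}"
  then show "forces P T (fImp (fSubset \<sigma> cohen_name) (fSubset \<tau> cohen_name))"
    unfolding forces_fImp forces_fSubset by blast
next
  fix \<sigma> \<tau> :: "('k \<times> bool) set" assume s: "\<sigma> \<in> seqs" "\<tau> \<in> seqs"
  show "forces P T (fImp (fAnd (fSubset \<sigma> cohen_name) (fSubset \<tau> cohen_name))
      (fBex {\<rho> \<in> seqs. \<sigma> \<subseteq> \<rho> \<and> \<tau> \<subseteq> \<rho>} (\<lambda>\<sigma>. fSubset \<sigma> cohen_name)))"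
    unfolding forces_fImp forces_fAnd
  proof (intro ballI impI)
    fix q assume q: "q \<in> P" "q \<subseteq> T"
      and f: "forces P q (fSubset \<sigma> cohen_name) \<and> forces P q (fSubset \<tau> cohen_name)"
    \<comment> \<open>Two sequences forced into the same function are compatible, hence comparable,
      so their union is the longer one and serves as common extension.\<close>
    have "single_valued (\<sigma> \<union> \<tau>)"
      by (rule single_valuedI, rule cohen_name_single_valued[OF q])
        (use f in \<open>auto simp: forces_fSubset\<close>)
    then have "\<sigma> \<subseteq> \<tau> \<or> \<tau> \<subseteq> \<sigma>" by (rule seqs_comparable[OF s])
    then have "\<sigma> \<union> \<tau> \<in> {\<rho> \<in> seqs. \<sigma> \<subseteq> \<rho> \<and> \<tau> \<subseteq> \<rho>}" using s by (auto simp: Un_absorb1 Un_absorb2)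
    moreover have "forces P r (fSubset (\<sigma> \<union> \<tau>) cohen_name)" if "r \<subseteq> q" for r
      using f forces_fSubset_mono[OF _ that] unfolding forces_fSubset by blast
    ultimately have "forces P q (fBex {\<rho> \<in> seqs. \<sigma> \<subseteq> \<rho> \<and> \<tau> \<subseteq> \<rho>} (\<lambda>\<sigma>. fSubset \<sigma> cohen_name))"
      unfolding forces_fBex by blast
    then show "\<exists>r\<in>P. r \<subseteq> q \<and>
        forces P r (fBex {\<rho> \<in> seqs. \<sigma> \<subseteq> \<rho> \<and> \<tau> \<subseteq> \<rho>} (\<lambda>\<sigma>. fSubset \<sigma> cohen_name))"
      using q by blast
  qed
next
  fix D :: "('k \<times> bool) set set" assume "D \<in> {D. dense_in (\<supseteq>) seqs D}"
  then show "forces P T (fBex D (\<lambda>\<sigma>. fSubset \<sigma> cohen_name))"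
    by (intro forces_cohen_name_meets) (auto simp: dense_in_def)
qed

lemma forces_cohen: "forces P T (fCohen cohen_name)"
  unfolding fCohen_def forces_fAnd using forces_cohen_name_function forces_cohen_name_generic ..

end

text \<open>Two distinct ordinals \<open>a < b\<close> stand for the truth values, which embeds
  binary sequences into \<kappa>^{<\<kappa>}.\<close>

lemma card_seqs_bool_le:
  assumes "\<And>\<alpha>::'k::wellorder. \<exists>\<beta>. \<alpha> < \<beta>"
  shows "|seqs :: ('k \<times> bool) set set| \<le>o |seqs :: ('k \<times> 'k) set set|"
proof -
  obtain a b :: 'k where "a < b" using assms by blast
  define f where "f = map_prod (id :: 'k \<Rightarrow> 'k) (\<lambda>c. if c then a else b)"
  have f: "inj f" unfolding f_def using \<open>a < b\<close> by (intro prod.inj_map) (auto simp: inj_on_def)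
  have "f ` t \<in> seqs" if t: "t \<in> seqs" for t
  proof -
    have "Domain (f ` t) = Domain t" unfolding f_def by force
    moreover have "single_valued (f ` t)"
      using seqs_single_valued[OF t] unfolding f_def single_valued_def by fastforce
    ultimately show ?thesis using t unfolding seqs_def by auto
  qed
  moreover have "inj_on (image f) seqs" using inj_image_eq_iff[OF f] by (auto simp: inj_on_def)
  ultimately show ?thesis using card_of_ordLeq by blast
qed

theorem theorem3:
  fixes P :: "('k::wellorder \<times> 'k) set set set"
    and T :: "('k \<times> 'k) set set"
    and h :: "('k \<times> 'k) set \<Rightarrow> ('k \<times> 'k) set"
  assumes "Card_order (ord_le :: 'k rel)"
    and "natLeq <o (ord_le :: 'k rel)"
    and "regularCard (ord_le :: 'k rel)"
    and "|seqs :: ('k \<times> 'k) set set| =o (ord_le :: 'k rel)"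
    and "tree_forcing P"
    and "lt_distributive (ord_le :: 'k rel) (\<subseteq>) P"
    and "pre_continuous h"
    and "T \<in> P"
    and "forces P T (fDominating (lim_name P h (x_gen P)))"
  shows "forces P T
    (fBex UNIV (\<lambda>c :: ('k \<times> bool, ('k \<times> 'k) set set) name. fCohen c))"
proof -
  interpret regular_uncountable "TYPE('k)" by unfold_locales fact+
  \<comment> \<open>The equation \<kappa>^{<\<kappa>} = \<kappa> yields \<open>code\<close> here
    and, by way of binary sequences, \<open>dec\<close> further on.\<close>
  have "|seqs :: ('k \<times> 'k) set set| \<le>o \<kappa>" using assms(4) by (rule ordIso_imp_ordLeq)
  moreover have "\<kappa> =o |UNIV :: 'k set|"
    using card_of_Field_ordIso[OF Card_order] ordIso_symmetric by (simp add: Field_ord_le)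
  ultimately have "|seqs :: ('k \<times> 'k) set set| \<le>o |UNIV :: 'k set|" by (rule ordLeq_ordIso_trans)
  then have "\<exists>code :: ('k \<times> 'k) set \<Rightarrow> 'k. inj_on code seqs \<and> code ` seqs \<subseteq> UNIV"
    by (rule iffD2[OF card_of_ordLeq])
  then obtain code :: "('k \<times> 'k) set \<Rightarrow> 'k" where code: "inj_on code seqs" by (elim exE conjE)
  have "|seqs :: ('k \<times> bool) set set| \<le>o \<kappa>"
    using card_seqs_bool_le[OF ex_greater] assms(4) by (rule ordLeq_ordIso_trans)
  moreover have "(seqs :: ('k \<times> bool) set set) \<noteq> {}" using seqs_empty by blast
  ultimately obtain dec :: "'k \<Rightarrow> ('k \<times> bool) set" where
    dec: "\<And>t. t \<in> seqs \<Longrightarrow> stat {\<alpha>. dec \<alpha> = t}"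
    using ex_stat_decoding[of "seqs :: ('k \<times> bool) set set"] by blast
  have h: "\<And>\<sigma>. \<sigma> \<in> seqs \<Longrightarrow> h \<sigma> \<in> seqs"
    "\<And>\<sigma> \<tau>. \<sigma> \<in> seqs \<Longrightarrow> \<tau> \<in> seqs \<Longrightarrow> \<sigma> \<subseteq> \<tau> \<Longrightarrow> h \<sigma> \<subseteq> h \<tau>"
    using assms(7) by (simp_all add: pre_continuous_def)
  show ?thesis
    unfolding forces_fBex
  proof (intro ballI impI)
    fix q assume q: "q \<in> P" "q \<subseteq> T"
    \<comment> \<open>Forcing an existential statement asks for a witness below every
      \<open>q\<close> under \<open>T\<close>. The construction is run with \<open>q\<close> in the
      place of \<open>T\<close>, and \<open>q\<close> itself forces the resulting name to be
      Cohen.\<close>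
    interpret dominated_tree_forcing "TYPE('k)" P q h code dec
    proof
      fix R assume R: "R \<in> P" "R \<subseteq> q"
      then have "R \<subseteq> T" using q(2) by blast
      show "\<exists>\<tau>\<in>R. \<alpha> \<in> Domain (h \<tau>)" for \<alpha>
        by (rule unbounded_of_dominating) fact+
      show "\<exists>R'\<in>P. R' \<subseteq> R \<and>
        (\<exists>\<alpha>\<^sub>0. \<forall>\<tau>\<in>R'. \<forall>\<alpha> \<beta>. (\<alpha>, \<beta>) \<in> h \<tau> \<longrightarrow> \<alpha>\<^sub>0 < \<alpha> \<longrightarrow> g \<alpha> \<le> \<beta>)" for g
        by (rule dominates_of_dominating) fact+
    qed (simp_all add: assms(5) h code dec)
    show "\<exists>c\<in>UNIV :: ('k \<times> bool, ('k \<times> 'k) set set) name set.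
      \<exists>r\<in>P. r \<subseteq> q \<and> forces P r (fCohen c)"
      by (intro bexI[of _ cohen_name] bexI[of _ q] conjI subset_refl forces_cohen q(1) UNIV_I)
  qed
qed

end
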